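(* Let $(W,S)$ be a Coxeter system of finite rank and $c$ a Coxeter element. The map $\pi_\downarrow^c:W\to W$ is order preserving for the (right) weak order: if $x\le y$ then $\pi_\downarrow^c(x)\le\pi_\downarrow^c(y)$.
   Context: $S$ finite; $T$ = reflections; $\mathrm{inv}(w)=\{t\in T:\ell(tw)<\ell(w)\}$; weak order $v\le w$ iff $\mathrm{inv}(v)\subseteq\mathrm{inv}(w)$. For $J\subseteq S$, $W_J=\langle J\rangle$ and $w_J\in W_J$ is the element with $\mathrm{inv}(w_J)=\mathrm{inv}(w)\cap W_J$; $\langle s\rangle:=S\setminus\{s\}$. A Coxeter element is $c=s_1\cdots s_n$ (all of $S$ in some order); $s$ is initial in $c$ if some reduced word of $c$ begins with $s$; then $scs$ is a Coxeter element of $W$ and $sc$ is a Coxeter element of $W_{\langle s\rangle}$. The map $\pi_\downarrow^c$ is defined recursively (on length and rank): $\pi_\downarrow^c(e)=e$, and for $s$ initial in $c$, $\pi_\downarrow^c(w)=s\,\pi_\downarrow^{scs}(sw)$ if $w\ge s$, and $\pi_\downarrow^c(w)=\pi_\downarrow^{sc}(w_{\langle s\rangle})$ if $w\not\ge s$, where $\pi_\downarrow^{sc}$ is the analogous map on $W_{\langle s\rangle}$. The result does not depend on the choices of initial letters. *)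

theory Defs
  imports "HOL-Algebra.Generated_Groups"
begin

(* m s t = 0 encodes the value infinity. *)
definition coxeter_matrix :: "'a set \<Rightarrow> ('a \<Rightarrow> 'a \<Rightarrow> nat) \<Rightarrow> bool" where
  "coxeter_matrix S m \<longleftrightarrow>
     (\<forall>s\<in>S. m s s = 1) \<and>
     (\<forall>s\<in>S. \<forall>t\<in>S. m s t = m t s \<and> (s \<noteq> t \<longrightarrow> m s t \<noteq> 1))"

(* Congruence on words over S generated by (s t)^(m s t) = 1.  For m s t = 0 the rule is
   trivial, i.e. no relation is imposed.  Since m s s = 1 gives s s = 1, every generator is
   its own inverse, so words in the letters of S (without formal inverses) suffice: the quotient
   of the words over S is the group presented by these relations. *)
inductive cox_cong :: "'a set \<Rightarrow> ('a \<Rightarrow> 'a \<Rightarrow> nat) \<Rightarrow> 'a list \<Rightarrow> 'a list \<Rightarrow> bool"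
  for S :: "'a set" and m :: "'a \<Rightarrow> 'a \<Rightarrow> nat" where
  refl: "u \<in> lists S \<Longrightarrow> cox_cong S m u u"
| sym: "cox_cong S m u v \<Longrightarrow> cox_cong S m v u"
| trans: "cox_cong S m u v \<Longrightarrow> cox_cong S m v w \<Longrightarrow> cox_cong S m u w"
| rel: "\<lbrakk>s \<in> S; t \<in> S; u \<in> lists S; v \<in> lists S\<rbrakk>
    \<Longrightarrow> cox_cong S m (u @ concat (replicate (m s t) [s, t]) @ v) (u @ v)"

definition word_prod :: "('a, 'b) monoid_scheme \<Rightarrow> 'a list \<Rightarrow> 'a" where
  "word_prod G u = foldr (mult G) u \<one>\<^bsub>G\<^esub>"

locale coxeter_system = group G for G (structure) +
  fixes S :: "'a set"
  assumes S_subset: "S \<subseteq> carrier G"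
    and S_generates: "generate G S = carrier G"
    and presentation:
      "\<exists>m. coxeter_matrix S m \<and>
         (\<forall>u\<in>lists S. \<forall>v\<in>lists S. word_prod G u = word_prod G v \<longleftrightarrow> cox_cong S m u v)"

(* The notions below take the generating set as an explicit argument and always refer to the
   group generated by it, so that they apply both to (W, S) and to a standard parabolic
   subgroup (W_J, J) with J a subset of S, multiplication being inherited from G. *)
context
  fixes G :: "('a, 'b) monoid_scheme" (structure)
begin

definition reflections :: "'a set \<Rightarrow> 'a set" where
  "reflections S = {w \<otimes> s \<otimes> inv w | w s. w \<in> generate G S \<and> s \<in> S}"

definition cox_length :: "'a set \<Rightarrow> 'a \<Rightarrow> nat" where
  "cox_length S w = (LEAST n. \<exists>u\<in>lists S. length u = n \<and> word_prod G u = w)"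

definition reduced_word :: "'a set \<Rightarrow> 'a \<Rightarrow> 'a list \<Rightarrow> bool" where
  "reduced_word S w u \<longleftrightarrow> u \<in> lists S \<and> word_prod G u = w \<and> length u = cox_length S w"

definition inversions :: "'a set \<Rightarrow> 'a \<Rightarrow> 'a set" where
  "inversions S w = {t \<in> reflections S. cox_length S (t \<otimes> w) < cox_length S w}"

definition weak_le :: "'a set \<Rightarrow> 'a \<Rightarrow> 'a \<Rightarrow> bool" where
  "weak_le S v w \<longleftrightarrow>
     v \<in> generate G S \<and> w \<in> generate G S \<and> inversions S v \<subseteq> inversions S w"

(* The element w_J of W_J; inversions are those in the ambient system (W, S). *)
definition parabolic_part :: "'a set \<Rightarrow> 'a set \<Rightarrow> 'a \<Rightarrow> 'a" where
  "parabolic_part S J w =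
     (THE v. v \<in> generate G J \<and> inversions S v = inversions S w \<inter> generate G J)"

definition coxeter_element :: "'a set \<Rightarrow> 'a \<Rightarrow> bool" where
  "coxeter_element S c \<longleftrightarrow> (\<exists>u. distinct u \<and> set u = S \<and> word_prod G u = c)"

definition initial_letter :: "'a set \<Rightarrow> 'a \<Rightarrow> 'a \<Rightarrow> bool" where
  "initial_letter S c s \<longleftrightarrow> (\<exists>u. reduced_word S c (s # u))"

(* pi_down_rel S c w p: some sequence of choices of initial letters in the recursion
   for the projection of w with respect to c, in the group generated by S, yields p. *)
inductive pi_down_rel :: "'a set \<Rightarrow> 'a \<Rightarrow> 'a \<Rightarrow> 'a \<Rightarrow> bool" where
  one: "pi_down_rel S c \<one> \<one>"
| above: "\<lbrakk>initial_letter S c s; weak_le S s w; pi_down_rel S (s \<otimes> c \<otimes> s) (s \<otimes> w) p\<rbrakk>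
    \<Longrightarrow> pi_down_rel S c w (s \<otimes> p)"
| not_above: "\<lbrakk>initial_letter S c s; \<not> weak_le S s w;
      pi_down_rel (S - {s}) (s \<otimes> c) (parabolic_part S (S - {s}) w) p\<rbrakk>
    \<Longrightarrow> pi_down_rel S c w p"

definition pi_down :: "'a set \<Rightarrow> 'a \<Rightarrow> 'a \<Rightarrow> 'a" where
  "pi_down S c w = (THE p. pi_down_rel S c w p)"

end

end

theory Submission
  imports Defs Complex_Main
begin

text \<open>Inversions are identified with the positive roots that \<open>w\<close> makes negative, in the geometric
  representation. Run the recursion along a fixed word of the Coxeter element and induct on rank
  plus length. If both or neither of \<open>x \<le> y\<close> lie above the initial letter \<open>s\<close>, the induction
  hypothesis applies directly; otherwise a maximal chain from \<open>x\<close> to \<open>y\<close> crosses \<open>s\<close> and one is left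
  with a cover \<open>x' < s x' = x' j\<close>. Write \<open>c = s d\<close>, and let \<open>p\<close> be the projection of \<open>x'\<close> with respect
  to \<open>d s\<close>, so that \<open>s p\<close> is the projection of \<open>s x'\<close> with respect to \<open>c\<close>. The recursion also produces
  the walls of the Cambrian cone containing \<open>x'\<close>. Since the Euler form of a word is invariant under
  rotation together with reflection, one shows that the root of \<open>s\<close> lies in the cone spanned
    by these
  walls, so, being simple for \<open>x'\<close>, it is a wall; as \<open>s\<close> is final in \<open>d s\<close>, this wall is simple for
  \<open>p\<close>, too. Hence \<open>p < s p\<close>. Finally the projection of \<open>x'\<close> with respect to \<open>c\<close> lies in the parabolic
  subgroup without \<open>s\<close>, is fixed by the recursion for \<open>d s\<close>, and so lies below \<open>p\<close> by induction.\<close>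

text \<open>In the mixed case the two recursions diverge: the one for \<open>x\<close> passes to the
  parabolic subgroup without \<open>s\<close>, the one for \<open>y\<close> to the rotated word, so
  the induction hypothesis does not apply to the pair. Length does not settle the comparison of
  \<open>p\<close> with \<open>s p\<close> either, since the weak order asks for inclusion of
  inversion sets. What must be shown is that \<open>s p = p i\<close> for a generator
  \<open>i\<close>, in other words that \<open>p\<close> carries some simple root to the root of
  \<open>s\<close>; this is why walls are recorded along with the projection.

  \<open>W\<close> may be infinite, so neither a longest element nor a finite root system is at
  hand. Only single inversion sets are finite, and their cardinality serves as the length in the
  inductions on the recursion. Fixing a word makes the recursion deterministic; that other choices
  of initial letters give the same result is a confluence argument for commuting letters. The
  representation is obtained from the presentation: relators are checked on vectors, and the signs
  of roots come from a reduction to rank two.\<close>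

section \<open>Linear combinations of coordinate functions, alternating words\<close>

definition lincomb :: "real \<Rightarrow> ('a \<Rightarrow> real) \<Rightarrow> real \<Rightarrow> ('a \<Rightarrow> real) \<Rightarrow> 'a \<Rightarrow> real" where
  "lincomb p u q v = (\<lambda>x. p * u x + q * v x)"

definition simple :: "'a \<Rightarrow> 'a \<Rightarrow> real" where
  "simple s = (\<lambda>x. if x = s then 1 else 0)"

text \<open>The alternating word of length \<open>k\<close> that ends in \<open>t\<close>. Growing
  it at the front keeps the last letter fixed and matches reflections being applied one after
  another.\<close>

fun alt :: "'a \<Rightarrow> 'a \<Rightarrow> nat \<Rightarrow> 'a list" where
  "alt s t 0 = []"
| "alt s t (Suc k) = (if even k then t else s) # alt s t k"

lemma simple_same [simp]: "simple s s = 1"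
  and simple_other: "x \<noteq> s \<Longrightarrow> simple s x = 0"
  by (auto simp: simple_def)

lemma lincomb_nonneg:
  "p \<ge> 0 \<Longrightarrow> q \<ge> 0 \<Longrightarrow> u x \<ge> 0 \<Longrightarrow> v x \<ge> 0 \<Longrightarrow> lincomb p u q v x \<ge> 0"
  by (simp add: lincomb_def)

lemma length_alt [simp]: "length (alt s t k) = k"
  by (induction k) auto

lemma set_alt: "set (alt s t k) \<subseteq> {s, t}"
  by (induction k) auto

lemma alt_double: "alt s t (2 * k) = concat (replicate k [s, t])"
  by (induction k) auto

lemma alternating_eq_alt:
  assumes "set y \<subseteq> {s, t}" and "\<And>a r c. y \<noteq> a @ r # r # c" and "y = [] \<or> last y = t"
  shows "y = alt s t (length y)"
  using assms
proof (induction y)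
  case (Cons r y)
  show ?case
  proof (cases y)
    case Nil
    then show ?thesis using Cons.prems by auto
  next
    case (Cons r' y')
    have "y = alt s t (length y)"
    proof (rule Cons.IH)
      show "\<And>a r c. y \<noteq> a @ r # r # c"
        using Cons.prems(2)[of "r # _"] by auto
    qed (use Cons.prems Cons in auto)
    then have hd: "r' = (if even (length y') then t else s)" and y: "y = alt s t (Suc (length y'))"
      using Cons by auto
    have "r \<noteq> r'" using Cons.prems(2)[of "[]"] Cons by auto
    moreover have "r \<in> {s, t}" using Cons.prems by auto
    ultimately have "r = (if even (length y) then t else s)"
      using hd Cons by (auto split: if_splits)
    then show ?thesis using y Cons by auto
  qed
qed simp

lemma alt_add: "\<exists>a. set a \<subseteq> {s, t} \<and> length a = j \<and> alt s t (j + k) = a @ alt s t k"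
proof (induction j)
  case (Suc j)
  then obtain a where "set a \<subseteq> {s, t}" "length a = j" "alt s t (j + k) = a @ alt s t k" by auto
  then show ?case by (intro exI[of _ "(if even (j + k) then t else s) # a"]) auto
qed simp

lemma alt_last: "k > 0 \<Longrightarrow> \<exists>a. set a \<subseteq> {s, t} \<and> alt s t k = a @ [t]"
  using alt_add[of s t "k - 1" 1] by auto

context group
begin

lemma word_prod_Nil [simp]: "word_prod G [] = \<one>"
  and word_prod_Cons [simp]: "word_prod G (s # u) = s \<otimes> word_prod G u"
  by (simp_all add: word_prod_def)

lemma word_prod_closed: "u \<in> lists (carrier G) \<Longrightarrow> word_prod G u \<in> carrier G"
  by (induction u) auto

lemma word_prod_append:
  "u \<in> lists (carrier G) \<Longrightarrow> v \<in> lists (carrier G) \<Longrightarrow>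
    word_prod G (u @ v) = word_prod G u \<otimes> word_prod G v"
  by (induction u) (auto simp: m_assoc word_prod_closed)

end

section \<open>The geometric representation\<close>

locale finite_coxeter_system = coxeter_system G S for G (structure) and S +
  fixes m :: "'a \<Rightarrow> 'a \<Rightarrow> nat"
  assumes finite_S: "finite S"
    and matrix: "coxeter_matrix S m"
    and pres: "\<And>u v. u \<in> lists S \<Longrightarrow> v \<in> lists S \<Longrightarrow>
      word_prod G u = word_prod G v \<longleftrightarrow> cox_cong S m u v"
begin

text \<open>For \<open>m s t = 0\<close>, that is infinite order, \<open>pi / 0 = 0\<close> gives the intended value \<open>-1\<close>.\<close>

definition form_entry :: "'a \<Rightarrow> 'a \<Rightarrow> real" where
  "form_entry s t = - cos (pi / real (m s t))"

definition form_simple :: "'a \<Rightarrow> ('a \<Rightarrow> real) \<Rightarrow> real" where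
  "form_simple s v = (\<Sum>t\<in>S. form_entry s t * v t)"

definition form :: "('a \<Rightarrow> real) \<Rightarrow> ('a \<Rightarrow> real) \<Rightarrow> real" where
  "form u v = (\<Sum>s\<in>S. u s * form_simple s v)"

definition simple_refl :: "'a \<Rightarrow> ('a \<Rightarrow> real) \<Rightarrow> 'a \<Rightarrow> real" where
  "simple_refl s v = lincomb 1 v (- 2 * form_simple s v) (simple s)"

definition word_refl :: "'a list \<Rightarrow> ('a \<Rightarrow> real) \<Rightarrow> 'a \<Rightarrow> real" where
  "word_refl u v = foldr simple_refl u v"

lemma m_same: "s \<in> S \<Longrightarrow> m s s = 1"
  and m_sym: "s \<in> S \<Longrightarrow> t \<in> S \<Longrightarrow> m s t = m t s"
  and m_neq_1: "s \<in> S \<Longrightarrow> t \<in> S \<Longrightarrow> s \<noteq> t \<Longrightarrow> m s t \<noteq> 1"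
  using matrix by (auto simp: coxeter_matrix_def)

lemma form_entry_same: "s \<in> S \<Longrightarrow> form_entry s s = 1"
  by (simp add: form_entry_def m_same)

lemma form_entry_sym: "s \<in> S \<Longrightarrow> t \<in> S \<Longrightarrow> form_entry s t = form_entry t s"
  by (simp add: form_entry_def m_sym)

lemma form_entry_nonpos:
  assumes "s \<in> S" "t \<in> S" "s \<noteq> t"
  shows "form_entry s t \<le> 0"
proof (cases "m s t = 0")
  case False
  then have "m s t \<ge> 2" using m_neq_1[OF assms] by linarith
  then have "pi / real (m s t) \<le> pi / 2"
    by (intro divide_left_mono) auto
  moreover have "- (pi / 2) \<le> 0" "0 \<le> pi / real (m s t)" by simp_all
  ultimately show ?thesis unfolding form_entry_def
    using cos_ge_zero[of "pi / real (m s t)"] by linarith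
qed (simp add: form_entry_def)

lemma form_simple_lincomb:
  "form_simple s (lincomb p u q v) = p * form_simple s u + q * form_simple s v"
  by (simp add: form_simple_def lincomb_def sum.distrib sum_distrib_left algebra_simps)

lemma form_simple_simple: "t \<in> S \<Longrightarrow> form_simple s (simple t) = form_entry s t"
  using finite_S by (simp add: form_simple_def simple_def if_distrib cong: if_cong)

lemma form_lc_right: "form w (lincomb p u q v) = p * form w u + q * form w v"
  by (simp add: form_def form_simple_lincomb sum.distrib sum_distrib_left algebra_simps)

lemma form_lc_left: "form (lincomb p u q v) w = p * form u w + q * form v w"
  by (simp add: form_def lincomb_def sum.distrib sum_distrib_left algebra_simps)

lemma form_simple_left: "s \<in> S \<Longrightarrow> form (simple s) v = form_simple s v"
  using finite_S by (simp add: form_def simple_def if_distrib[where f = "\<lambda>x. x * _"] cong: if_cong)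

lemma form_sym: "form u v = form v u"
proof -
  have "form u v = (\<Sum>s\<in>S. \<Sum>t\<in>S. u s * form_entry s t * v t)"
    by (simp add: form_def form_simple_def sum_distrib_left mult.assoc)
  also have "\<dots> = (\<Sum>t\<in>S. \<Sum>s\<in>S. u s * form_entry s t * v t)"
    by (rule sum.swap)
  also have "\<dots> = form v u"
    by (auto simp: form_def form_simple_def sum_distrib_left form_entry_sym intro!: sum.cong)
  finally show ?thesis .
qed

lemma form_simple_right: "s \<in> S \<Longrightarrow> form v (simple s) = form_simple s v"
  using form_simple_left form_sym by simp

lemma form_simple_self: "s \<in> S \<Longrightarrow> form_simple s (simple s) = 1"
  by (simp add: form_simple_simple form_entry_same)

lemma form_simple_refl: "s \<in> S \<Longrightarrow> form (simple_refl s u) (simple_refl s v) = form u v"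
  by (simp add: simple_refl_def form_lc_left form_lc_right form_simple_left form_simple_right form_simple_self algebra_simps)

lemma simple_refl_lincomb:
  "simple_refl s (lincomb p u q v) = lincomb p (simple_refl s u) q (simple_refl s v)"
  by (simp add: simple_refl_def form_simple_lincomb) (simp add: lincomb_def fun_eq_iff algebra_simps)

lemma simple_refl_simple: "s \<in> S \<Longrightarrow> simple_refl s (simple s) = lincomb (-1) (simple s) 0 (simple s)"
  by (simp add: simple_refl_def form_simple_self) (simp add: lincomb_def fun_eq_iff)

lemma form_simple_simple_refl: "s \<in> S \<Longrightarrow> form_simple s (simple_refl s v) = - form_simple s v"
  by (simp add: simple_refl_def form_simple_lincomb form_simple_self)

lemma simple_refl_simple_refl: "s \<in> S \<Longrightarrow> simple_refl s (simple_refl s v) = v"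
  by (subst simple_refl_def) (simp add: form_simple_simple_refl, simp add: simple_refl_def lincomb_def fun_eq_iff)

lemma simple_refl_other: "x \<noteq> s \<Longrightarrow> simple_refl s v x = v x"
  by (simp add: simple_refl_def lincomb_def simple_other)

lemma simple_refl_at: "simple_refl s v s = v s - 2 * form_simple s v"
  by (simp add: simple_refl_def lincomb_def)

lemma word_refl_Nil [simp]: "word_refl [] v = v"
  and word_refl_Cons [simp]: "word_refl (s # u) v = simple_refl s (word_refl u v)"
  and word_refl_append: "word_refl (u @ u') v = word_refl u (word_refl u' v)"
  by (simp_all add: word_refl_def)

lemma word_refl_lincomb:
  "word_refl w (lincomb p u q v) = lincomb p (word_refl w u) q (word_refl w v)"
  by (induction w) (auto simp: simple_refl_lincomb)

lemma form_word_refl: "w \<in> lists S \<Longrightarrow> form (word_refl w u) (word_refl w v) = form u v"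
  by (induction w) (auto simp: form_simple_refl)

lemma word_refl_rev: "w \<in> lists S \<Longrightarrow> word_refl (rev w) (word_refl w v) = v"
  by (induction w arbitrary: v) (auto simp: simple_refl_simple_refl word_refl_append)

lemma word_refl_other: "x \<notin> set w \<Longrightarrow> word_refl w v x = v x"
  by (induction w) (auto simp: simple_refl_other)

text \<open>The value is \<open>sin (k * \<theta>) / sin \<theta>\<close> for \<open>\<theta> = pi / n\<close>, except that \<open>n = 0\<close>
  (hence \<open>\<theta> = 0\<close>) gives \<open>k\<close>.\<close>

fun cheb :: "nat \<Rightarrow> nat \<Rightarrow> real" where
  "cheb n 0 = 0"
| "cheb n (Suc 0) = 1"
| "cheb n (Suc (Suc k)) = 2 * cos (pi / real n) * cheb n (Suc k) - cheb n k"

lemma cheb_0: "cheb 0 k = real k"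
  by (induction "0::nat" k rule: cheb.induct) auto

lemma cheb_sin: "cheb n k * sin (pi / real n) = sin (real k * (pi / real n))"
proof (induction n k rule: cheb.induct)
  case (3 n k)
  let ?t = "pi / real n"
  have "sin (real (Suc (Suc k)) * ?t) = sin (real (Suc k) * ?t + ?t)"
    by (rule arg_cong[of _ _ sin]) (simp add: algebra_simps add_divide_distrib)
  moreover have "sin (real k * ?t) = sin (real (Suc k) * ?t - ?t)"
    by (rule arg_cong[of _ _ sin]) (simp add: algebra_simps add_divide_distrib)
  ultimately have "sin (real (Suc (Suc k)) * ?t) + sin (real k * ?t) =
      2 * cos ?t * sin (real (Suc k) * ?t)"
    unfolding sin_add sin_diff by simp
  then show ?case using 3 by (simp add: algebra_simps)
qed auto

lemma sin_pos: "n \<ge> 2 \<Longrightarrow> sin (pi / real n) > 0"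
  by (rule sin_gt_zero) (auto simp: field_simps)

text \<open>For \<open>n \<ge> 2\<close> and \<open>k \<le> n\<close> the angle
  \<open>k * pi / n\<close> stays between 0 and \<open>pi\<close>, where the sine is nonnegative;
  for \<open>n = 0\<close> the value is \<open>k\<close>.\<close>

lemma cheb_nonneg:
  assumes "n \<noteq> 1" "n = 0 \<or> k \<le> n"
  shows "cheb n k \<ge> 0"
proof (cases "n = 0")
  case False
  then have n: "n \<ge> 2" "k \<le> n" using assms by auto
  have "sin (real k * (pi / real n)) \<ge> 0"
  proof (rule sin_ge_zero)
    show "real k * (pi / real n) \<le> pi" using n by (simp add: field_simps)
  qed auto
  then show ?thesis using cheb_sin[of n k] sin_pos[OF n(1)]
    by (metis mult_less_0_iff not_less)
qed (simp add: cheb_0)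

lemma cheb_period:
  assumes "n \<ge> 2"
  shows "cheb n (2 * n) = 0" "cheb n (Suc (2 * n)) = 1"
proof -
  have *: "real (2 * n) * (pi / real n) = 2 * pi" using assms by simp
  have "cheb n (2 * n) * sin (pi / real n) = 0"
    unfolding cheb_sin * by simp
  then show "cheb n (2 * n) = 0" using sin_pos[OF assms] by simp
  have "real (Suc (2 * n)) * (pi / real n) = 2 * pi + pi / real n"
    using assms by (simp add: field_simps)
  then have "cheb n (Suc (2 * n)) * sin (pi / real n) = sin (pi / real n)"
    unfolding cheb_sin by (simp add: sin_add)
  then show "cheb n (Suc (2 * n)) = 1" using sin_pos[OF assms] by simp
qed

text \<open>For distinct \<open>s\<close> and \<open>t\<close>, each new reflection replaces only
  its own coordinate, by \<open>2 * cos (pi / m s t)\<close> times the other coordinate minus the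
  old value. This is the recurrence of \<open>cheb\<close>.\<close>

lemma word_refl_alt:
  assumes "s \<in> S" "t \<in> S"
  shows "word_refl (alt s t k) (simple s) =
    (if even k then lincomb (cheb (m s t) (Suc k)) (simple s) (cheb (m s t) k) (simple t)
     else lincomb (cheb (m s t) k) (simple s) (cheb (m s t) (Suc k)) (simple t))"
proof (induction k)
  case 0
  show ?case by (simp add: lincomb_def)
next
  case (Suc k)
  have "form_entry s t = - cos (pi / real (m s t))" "form_entry t s = - cos (pi / real (m s t))"
    using form_entry_sym assms by (auto simp: form_entry_def)
  then show ?case
    using assms by (simp add: Suc simple_refl_def form_simple_lincomb form_simple_simple form_entry_same)
      (auto simp add: lincomb_def fun_eq_iff algebra_simps)
qed

lemma word_refl_relation_simple:
  assumes "s \<in> S" "t \<in> S" "s \<noteq> t"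
  shows "word_refl (concat (replicate (m s t) [s, t])) (simple s) = simple s"
proof (cases "m s t = 0")
  case False
  then have "m s t \<ge> 2" using m_neq_1[OF assms] by linarith
  then show ?thesis using word_refl_alt[OF assms(1,2), of "2 * m s t"]
    by (simp add: alt_double cheb_period) (simp add: lincomb_def)
qed simp

lemma rev_relation: "rev (concat (replicate k [s, t])) = concat (replicate k [t, s])"
proof (induction k)
  case (Suc k)
  have "concat (replicate k [t, s]) @ [t, s] = [t, s] @ concat (replicate k [t, s])" for k
    by (induction k) auto
  then show ?case using Suc by simp
qed simp

lemma relation_in_lists: "s \<in> S \<Longrightarrow> t \<in> S \<Longrightarrow> concat (replicate k [s, t]) \<in> lists S"
  by (induction k) auto

lemma word_refl_fixed: "(\<And>s. s \<in> set w \<Longrightarrow> form_simple s v = 0) \<Longrightarrow> word_refl w v = v"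
  by (induction w) (auto simp: simple_refl_def lincomb_def)

text \<open>For distinct letters with a finite bond the form is nondegenerate on the plane of the
  two simple roots. So \<open>v\<close> splits into a vector orthogonal to both, fixed by every
  letter, and a vector of the plane, where the rotation is known. For an infinite bond the relator
  is empty.\<close>

lemma word_refl_relation:
  assumes "s \<in> S" "t \<in> S"
  shows "word_refl (concat (replicate (m s t) [s, t])) v = v"
proof (cases "s = t")
  case True
  then show ?thesis using assms by (simp add: m_same simple_refl_simple_refl)
next
  case neq: False
  let ?r = "concat (replicate (m s t) [s, t])"
  show ?thesis
  proof (cases "m s t = 0")
    case False
    then have m2: "m s t \<ge> 2" using m_neq_1[OF assms neq] by linarith
    \<comment> \<open>Cramer's rule for the Gram matrix of the two simple roots. Its determinant is
      the squared sine of \<open>pi / m s t\<close>, hence nonzero.\<close>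
    define p where
      "p = (form_simple s v - form_entry s t * form_simple t v) / (1 - (form_entry s t)\<^sup>2)"
    define q where
      "q = (form_simple t v - form_entry s t * form_simple s v) / (1 - (form_entry s t)\<^sup>2)"
    define v0 where "v0 = lincomb 1 v (-1) (lincomb p (simple s) q (simple t))"
    have "1 - (form_entry s t)\<^sup>2 = (sin (pi / real (m s t)))\<^sup>2"
      by (simp add: form_entry_def sin_squared_eq)
    then have nz: "1 - (form_entry s t)\<^sup>2 \<noteq> 0" using sin_pos[OF m2] by auto
    have p: "p + form_entry s t * q = form_simple s v" and q:
      "form_entry s t * p + q = form_simple t v"
    proof -
      have "p + form_entry s t * q = (form_simple s v * (1 - (form_entry s t)\<^sup>2)) / (1 - (form_entry s t)\<^sup>2)"
        unfolding p_def q_def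
          by (simp add: add_divide_distrib [symmetric] algebra_simps power2_eq_square)
      then show "p + form_entry s t * q = form_simple s v" using nz by simp
      have "form_entry s t * p + q = (form_simple t v * (1 - (form_entry s t)\<^sup>2)) / (1 - (form_entry s t)\<^sup>2)"
        unfolding p_def q_def
          by (simp add: add_divide_distrib [symmetric] algebra_simps power2_eq_square)
      then show "form_entry s t * p + q = form_simple t v" using nz by simp
    qed
    have "form_simple s v0 = 0" "form_simple t v0 = 0"
      using p q assms form_entry_sym[OF assms] unfolding v0_def
        by (simp_all add: form_simple_lincomb form_simple_simple form_entry_same algebra_simps)
    then have v0: "word_refl ?r v0 = v0"
      using set_alt[of s t "2 * m s t"] unfolding alt_double by (intro word_refl_fixed) blast
    have v: "v = lincomb 1 v0 1 (lincomb p (simple s) q (simple t))"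
      by (simp add: v0_def lincomb_def)
    \<comment> \<open>The reversed relator inverts the relator and is itself the relator of the pair
      \<open>t\<close>, \<open>s\<close>; so the computation for one simple root also covers the
      other.\<close>
    have "word_refl (rev ?r) (simple t) = simple t"
      unfolding rev_relation using word_refl_relation_simple[of t s] assms neq m_sym by auto
    then have "word_refl ?r (simple t) = simple t"
      using word_refl_rev[of "rev ?r" "simple t"] relation_in_lists[OF assms]
      by (metis in_listsD in_listsI rev_rev_ident set_rev)
    then have "word_refl ?r (lincomb 1 v0 1 (lincomb p (simple s) q (simple t))) =
        lincomb 1 v0 1 (lincomb p (simple s) q (simple t))"
      unfolding word_refl_lincomb using v0 word_refl_relation_simple[OF assms neq] by simp
    then show ?thesis using v by simp
  qed simp
qed

lemma cox_cong_word_refl: "cox_cong S m u u' \<Longrightarrow> word_refl u v = word_refl u' v"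
proof (induction arbitrary: v rule: cox_cong.induct)
  case (rel s t u u')
  then show ?case by (simp add: word_refl_append word_refl_relation)
qed simp_all

text \<open>All relators have even length; this is the sign character of the group.\<close>

lemma cox_cong_parity: "cox_cong S m u u' \<Longrightarrow> even (length u) = even (length u')"
proof (induction rule: cox_cong.induct)
  case (rel s t u u')
  have "length (concat (replicate k [s, t])) = 2 * k" for k
    by (induction k) auto
  then show ?case by simp
qed simp_all

section \<open>Words and lengths in standard parabolic subgroups\<close>

lemma S_carrier: "s \<in> S \<Longrightarrow> s \<in> carrier G"
  using S_subset by auto

lemma lists_carrier: "J \<subseteq> S \<Longrightarrow> u \<in> lists J \<Longrightarrow> u \<in> lists (carrier G)"
  using S_subset by auto

lemma lists_S: "J \<subseteq> K \<Longrightarrow> u \<in> lists J \<Longrightarrow> u \<in> lists K"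
  by auto

lemma wp_closed: "u \<in> lists S \<Longrightarrow> word_prod G u \<in> carrier G"
  by (rule word_prod_closed[OF lists_carrier[of S]]) auto

lemma wp_append: "u \<in> lists S \<Longrightarrow> v \<in> lists S \<Longrightarrow>
    word_prod G (u @ v) = word_prod G u \<otimes> word_prod G v"
  by (rule word_prod_append; rule lists_carrier[of S]) auto

lemma S_square:
  assumes "s \<in> S"
  shows "s \<otimes> s = \<one>"
proof -
  have "cox_cong S m ([] @ concat (replicate (m s s) [s, s]) @ []) ([] @ [])"
    using assms by (intro cox_cong.rel) auto
  then have "cox_cong S m [s, s] []" using assms by (simp add: m_same)
  then have "word_prod G [s, s] = word_prod G []" using assms by (subst pres) auto
  then show ?thesis using assms S_carrier by simp
qed

lemma S_inv: "s \<in> S \<Longrightarrow> inv s = s"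
  using S_square S_carrier by (metis inv_equality)

lemma S_cancel: "s \<in> S \<Longrightarrow> g \<in> carrier G \<Longrightarrow> s \<otimes> (s \<otimes> g) = g"
  using S_square S_carrier by (metis l_one m_assoc)

lemma S_cancel_right: "s \<in> S \<Longrightarrow> g \<in> carrier G \<Longrightarrow> g \<otimes> s \<otimes> s = g"
  using S_square S_carrier by (metis r_one m_assoc)


lemma wp_in_generate: "J \<subseteq> S \<Longrightarrow> u \<in> lists J \<Longrightarrow> word_prod G u \<in> generate G J"
  by (induction u) (auto intro: generate.intros)

lemma generate_carrier: "J \<subseteq> S \<Longrightarrow> w \<in> generate G J \<Longrightarrow> w \<in> carrier G"
  using generate_in_carrier[of J w] S_subset by auto

lemma generate_word:
  assumes "J \<subseteq> S" "w \<in> generate G J"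
  shows "\<exists>u\<in>lists J. word_prod G u = w"
  using assms(2)
proof (induction w rule: generate.induct)
  case one
  then show ?case by (intro bexI[of _ "[]"]) auto
next
  case (incl h)
  then show ?case using assms(1) S_carrier by (intro bexI[of _ "[h]"]) auto
next
  case (inv h)
  then show ?case using assms(1) S_carrier S_inv[of h] by (intro bexI[of _ "[h]"]) auto
next
  case (eng h1 h2)
  then obtain u1 u2 where "u1 \<in> lists J" "word_prod G u1 = h1" "u2 \<in> lists J" "word_prod G u2 = h2"
    by auto
  then show ?case using assms(1) lists_S[of J]
    by (intro bexI[of _ "u1 @ u2"]) (auto simp: wp_append)
qed

lemma generate_mult: "w \<in> generate G J \<Longrightarrow> w' \<in> generate G J \<Longrightarrow> w \<otimes> w' \<in> generate G J"
  by (rule generate.eng)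

lemma generate_inv: "J \<subseteq> S \<Longrightarrow> w \<in> generate G J \<Longrightarrow> inv w \<in> generate G J"
  using generate_m_inv_closed[of J w] S_subset by auto

lemma generate_simple: "s \<in> J \<Longrightarrow> s \<in> generate G J"
  by (rule generate.incl)

lemma generate_mono: "J \<subseteq> K \<Longrightarrow> w \<in> generate G J \<Longrightarrow> w \<in> generate G K"
  using mono_generate by blast

lemma carrier_word: "g \<in> carrier G \<Longrightarrow> \<exists>u\<in>lists S. word_prod G u = g"
  using generate_word[of S g] S_generates by auto

lemma wp_parity:
  assumes "u \<in> lists S" "v \<in> lists S" "word_prod G u = word_prod G v"
  shows "even (length u) = even (length v)"
  using assms pres cox_cong_parity by blast

lemma reduced_exists:
  assumes "J \<subseteq> S" "w \<in> generate G J"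
  obtains u where "u \<in> lists J" "word_prod G u = w" "length u = cox_length G J w"
proof -
  have "\<exists>n. \<exists>u\<in>lists J. length u = n \<and> word_prod G u = w"
    using generate_word[OF assms] by auto
  then show ?thesis
    using LeastI_ex[of "\<lambda>n. \<exists>u\<in>lists J. length u = n \<and> word_prod G u = w"] that
    unfolding cox_length_def by auto
qed

lemma cox_length_le: "u \<in> lists J \<Longrightarrow> cox_length G J (word_prod G u) \<le> length u"
  unfolding cox_length_def by (rule Least_le) auto


lemma cox_length_mult_word:
  assumes "J \<subseteq> S" "w \<in> generate G J" "u \<in> lists J"
  shows "cox_length G J (w \<otimes> word_prod G u) \<le> cox_length G J w + length u"
proof -
  obtain v where v: "v \<in> lists J" "word_prod G v = w" "length v = cox_length G J w"
    using reduced_exists[OF assms(1,2)] .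
  then show ?thesis using cox_length_le[of "v @ u" J] assms lists_S[of J]
    by (simp add: wp_append)
qed

lemma cox_length_parity:
  assumes "J \<subseteq> S" "u \<in> lists J"
  shows "even (cox_length G J (word_prod G u)) = even (length u)"
proof -
  obtain v where "v \<in> lists J" "word_prod G v = word_prod G u"
      "length v = cox_length G J (word_prod G u)"
    using reduced_exists[OF assms(1) wp_in_generate[OF assms]] .
  then show ?thesis using wp_parity[of v u] lists_S[OF assms(1)] assms(2) by metis
qed

text \<open>The two lengths differ by at most one, and equality is excluded by parity.\<close>

lemma cox_length_mult_simple:
  assumes "J \<subseteq> S" "w \<in> generate G J" "s \<in> J"
  shows "cox_length G J (w \<otimes> s) = Suc (cox_length G J w) \<or>
    cox_length G J w = Suc (cox_length G J (w \<otimes> s))"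
proof -
  have s: "s \<in> carrier G" "s \<in> S" using assms S_carrier by auto
  have w: "w \<in> carrier G" using assms generate_carrier by auto
  have ws: "w \<otimes> s \<in> generate G J"
    by (rule generate_mult[OF assms(2) generate_simple[OF assms(3)]])
  have "cox_length G J (w \<otimes> s) \<le> cox_length G J w + 1"
    using cox_length_mult_word[OF assms(1,2), of "[s]"] assms(3) s by simp
  moreover have "cox_length G J w \<le> cox_length G J (w \<otimes> s) + 1"
    using cox_length_mult_word[OF assms(1) ws, of "[s]"] assms(3) s w
    by (simp add: S_cancel_right)
  moreover obtain u where u: "u \<in> lists J" "word_prod G u = w"
    using generate_word[OF assms(1,2)] by auto
  then have "word_prod G (u @ [s]) = w \<otimes> s" 
    using assms s lists_S[of J] by (subst wp_append) auto
  then have "even (cox_length G J (w \<otimes> s)) \<noteq> even (cox_length G J w)"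
    using cox_length_parity[OF assms(1), of
      "u @ [s]"] cox_length_parity[OF assms(1) u(1)] u assms(3)
    by simp
  ultimately show ?thesis by presburger
qed

section \<open>The action of the group and the sign of roots\<close>

text \<open>Congruent words reflect alike, so the arbitrary choice of a word does not affect the
  value.\<close>

definition act :: "'a \<Rightarrow> ('a \<Rightarrow> real) \<Rightarrow> 'a \<Rightarrow> real" where
  "act g = word_refl (SOME u. u \<in> lists S \<and> word_prod G u = g)"

lemma act_word: "u \<in> lists S \<Longrightarrow> act (word_prod G u) v = word_refl u v"
proof -
  assume u: "u \<in> lists S"
  let ?u = "SOME u'. u' \<in> lists S \<and> word_prod G u' = word_prod G u"
  have "?u \<in> lists S \<and> word_prod G ?u = word_prod G u"
    by (rule someI[of _ u]) (use u in auto)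
  then show ?thesis unfolding act_def using u pres cox_cong_word_refl by blast
qed

lemma act_one: "act \<one> v = v"
  using act_word[of "[]"] by simp

lemma act_simple: "s \<in> S \<Longrightarrow> act s v = simple_refl s v"
  using act_word[of "[s]"] S_carrier by simp

lemma act_mult:
  assumes "g \<in> carrier G" "h \<in> carrier G"
  shows "act (g \<otimes> h) v = act g (act h v)"
proof -
  obtain u u' where "u \<in> lists S" "word_prod G u = g" "u' \<in> lists S" "word_prod G u' = h"
    using carrier_word assms by meson
  then show ?thesis using act_word[of "u @ u'"] act_word[of u] act_word[of u']
    by (auto simp: wp_append word_refl_append)
qed

lemma act_inv: "g \<in> carrier G \<Longrightarrow> act (inv g) (act g v) = v"
  by (metis act_mult act_one inv_closed l_inv)

lemma act_inv': "g \<in> carrier G \<Longrightarrow> act g (act (inv g) v) = v"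
  by (metis act_mult act_one inv_closed r_inv)

lemma act_lincomb: "act g (lincomb p u q v) = lincomb p (act g u) q (act g v)"
  unfolding act_def by (rule word_refl_lincomb)

lemma form_act: "g \<in> carrier G \<Longrightarrow> form (act g u) (act g v) = form u v"
  by (metis form_word_refl act_word carrier_word)

text \<open>The relator of length \<open>2 * m s t\<close> is cut in the middle: moving its letters
  one at a time to the other side of the equation builds up the alternating word that ends in
  \<open>s\<close>.\<close>

lemma alt_braid:
  assumes "s \<in> S" "t \<in> S"
  shows "word_prod G (alt s t (m s t)) = word_prod G (alt t s (m s t))"
proof -
  let ?n = "m s t"
  have alt: "alt s t k \<in> lists S" "alt t s k \<in> lists S" for k
    using set_alt[of s t k] set_alt[of t s k] assms by (auto simp: in_lists_conv_set)
  have "cox_cong S m ([] @ concat (replicate (m s t) [s, t]) @ []) ([] @ [])"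
    using assms by (intro cox_cong.rel) auto
  then have "word_prod G (alt s t (2 * ?n)) = word_prod G []"
    using relation_in_lists[OF assms] by (subst pres) (auto simp: alt_double simp del: set_concat)
  then have one: "word_prod G (alt s t (2 * ?n)) = \<one>" by simp
  have "j \<le> 2 * ?n \<Longrightarrow> word_prod G (alt s t (2 * ?n - j)) = word_prod G (alt t s j)" for j
  proof (induction j)
    case (Suc j)
    define k where "k = 2 * ?n - Suc j"
    define r where "r = (if even k then t else s)"
    have k: "2 * ?n - j = Suc k" using Suc.prems by (simp add: k_def)
    have "even k = odd j" using Suc.prems unfolding k_def by auto
    then have r: "alt s t (Suc k) = r # alt s t k" "alt t s (Suc j) = r # alt t s j"
      by (auto simp: r_def)
    have rS: "r \<in> S" using assms by (auto simp: r_def)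
    have "r \<otimes> word_prod G (alt s t k) = word_prod G (alt t s j)"
      using Suc unfolding k r by simp
    then have "word_prod G (alt s t k) = r \<otimes> word_prod G (alt t s j)"
      using S_cancel[OF rS] wp_closed[OF alt(1)] by metis
    then show ?case unfolding r k_def[symmetric] by simp
  qed (use one in simp)
  from this[of ?n] show ?thesis by (simp add: mult_2)
qed

text \<open>Factor \<open>w = v y\<close> with \<open>y\<close> a longest possible word in the rank-two parabolic subgroup of \<open>s\<close>
  and a descent \<open>t\<close> of \<open>w\<close>; then \<open>v\<close> has no descent in it, and \<open>y\<close> is too short to make
  \<open>simple s\<close> negative.\<close>

lemma act_simple_nonneg:
  assumes "J \<subseteq> S" "w \<in> generate G J" "s \<in> J"
    and "cox_length G J w < cox_length G J (w \<otimes> s)"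
  shows "act w (simple s) x \<ge> 0"
  using assms(2-)
proof (induction "cox_length G J w" arbitrary: w s rule: less_induct)
  case less
  let ?L = "cox_length G J"
  have s: "s \<in> S" using less assms(1) by auto
  obtain u where u: "u \<in> lists J" "word_prod G u = w" "length u = ?L w"
    using reduced_exists[OF assms(1) less.prems(1)] .
  show ?case
  proof (cases u rule: rev_cases)
    case Nil
    then show ?thesis using u by (auto simp: act_one simple_def)
  next
    case (snoc u' t)
    have t: "t \<in> J" "t \<in> S" and u': "u' \<in> lists J" using u snoc assms(1) by auto
    define Q where "Q y \<longleftrightarrow> y \<in> lists {s, t} \<and>
      (\<exists>v\<in>generate G J. w = v \<otimes> word_prod G y \<and> ?L v + length y = ?L w)" for y
    have "w = word_prod G u' \<otimes> t"
      using u snoc t lists_S[OF assms(1) u'] S_carrier by (simp add: wp_append)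
    moreover have "?L (word_prod G u') + 1 = ?L w"
      using cox_length_le[OF u'] cox_length_mult_simple[OF assms(1) wp_in_generate[OF assms(1) u'] t(1)]
        u snoc calculation by auto
    ultimately have Qt: "Q [t]"
      unfolding Q_def using wp_in_generate[OF assms(1) u'] t S_carrier by auto
    have "\<exists>y. Q y \<and> (\<forall>z. Q z \<longrightarrow> length z \<le> length y)"
      by (rule ex_has_greatest_nat[of Q "[t]" length "Suc (?L w)"]) (use Qt in \<open>auto simp: Q_def\<close>)
    then obtain y where Qy: "Q y" and max: "\<And>z. Q z \<Longrightarrow> length z \<le> length y" by blast
    then obtain v where y: "y \<in> lists {s, t}" and v: "v \<in> generate G J" "w = v \<otimes> word_prod G y"
      and Lv: "?L v + length y = ?L w" unfolding Q_def by auto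
    have stJ: "{s, t} \<subseteq> J" "{s, t} \<subseteq> S" using t less.prems s by auto
    have vc: "v \<in> carrier G" using v assms(1) generate_carrier by auto
    have up: "?L v < ?L (v \<otimes> r)" if "r \<in> {s, t}" for r
    proof (rule ccontr)
      assume "\<not> ?thesis"
      then have "?L v = Suc (?L (v \<otimes> r))"
        using cox_length_mult_simple[OF assms(1) v(1), of r] stJ that by auto
      moreover have rS: "r \<in> S" using that stJ by auto
      have "w = (v \<otimes> r) \<otimes> word_prod G (r # y)"
        using v(2) vc S_carrier[OF rS] S_cancel[OF rS] wp_closed[OF lists_S[OF stJ(2) y]]
        by (simp add: m_assoc)
      moreover have "v \<otimes> r \<in> generate G J"
        using generate_mult[OF v(1) generate_simple[of r J]] that stJ by auto
      ultimately have "Q (r # y)" unfolding Q_def using y that Lv by auto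
      then show False using max[of "r # y"] by simp
    qed
    have "length y \<ge> 1" using max[OF Qt] by simp
    then have "?L v < ?L w" using Lv by linarith
    then have IH: "act v (simple r) x \<ge> 0" if "r \<in> {s, t}" for r
      using less.hyps[of v r] v(1) up[OF that] that stJ by blast
    \<comment> \<open>A shorter word for the same rank-two element would shorten \<open>w\<close>.
      Consequently no letter of \<open>y\<close> is repeated in adjacent places.\<close>
    have short: "length y \<le> length z" if "z \<in> lists {s, t}" "word_prod G z = word_prod G y" for z
      using cox_length_mult_word[OF assms(1) v(1) lists_S[OF stJ(1) that(1)]] that(2) v(2) Lv
      by simp
    \<comment> \<open>If \<open>y\<close> could be rewritten, at the same length, to end in
      \<open>s\<close>, then \<open>w \<otimes> s\<close> would be shorter than
      \<open>w\<close>.\<close>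
    have no_s: "word_prod G y \<noteq> word_prod G (z @ [s])"
      if "z \<in> lists {s, t}" "length y = Suc (length z)" for z
    proof
      assume eq: "word_prod G y = word_prod G (z @ [s])"
      have "w \<otimes> s = v \<otimes> word_prod G z"
        using v(2) eq that(1) s vc S_carrier wp_closed[OF lists_S[OF stJ(2)]] lists_S[OF stJ(2)]
        by (simp add: wp_append m_assoc S_square S_cancel_right)
      then have "?L (w \<otimes> s) \<le> ?L v + length z"
        using cox_length_mult_word[OF assms(1) v(1), of z] that(1) lists_S[OF stJ(1)] stJ by auto
      then show False using less.prems(3) Lv that(2) by linarith
    qed
    have y_alt: "y = alt s t (length y)"
    proof (rule alternating_eq_alt)
      show "set y \<subseteq> {s, t}" using y by auto
      show "y \<noteq> a @ r # r # c" for a r c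
      proof
        assume eq: "y = a @ r # r # c"
        then have "a \<in> lists {s, t}" "c \<in> lists {s, t}" "r \<in> S" using y stJ by auto
        then have "word_prod G (a @ c) = word_prod G y"
          using eq wp_closed[of c] lists_S[OF stJ(2)] by (simp add: wp_append S_cancel)
        then show False using short[of "a @ c"] eq y by auto
      qed
      show "y = [] \<or> last y = t"
      proof (cases y rule: rev_cases)
        case (snoc z r)
        then show ?thesis using y no_s[of z] by auto
      qed simp
    qed
    \<comment> \<open>With \<open>m s t\<close> or more letters, the end of \<open>y\<close> is one
      side of the braid relation; the other side ends in \<open>s\<close>, which has just been
      excluded.\<close>
    have len: "m s t = 0 \<or> length y < m s t"
    proof (rule ccontr)
      assume "\<not> ?thesis"
      then have M: "m s t > 0" "m s t \<le> length y" by auto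
      obtain a where a: "set a \<subseteq> {s, t}" "length a = length y - m s t"
          "alt s t (length y - m s t + m s t) = a @ alt s t (m s t)"
        using alt_add[of s t "length y - m s t" "m s t"] by auto
      obtain z where z: "set z \<subseteq> {t, s}" "alt t s (m s t) = z @ [s]"
        using alt_last[OF M(1), of t s] by auto
      have "alt s t (length y) = a @ alt s t (m s t)"
        using a(3) unfolding le_add_diff_inverse2[OF M(2)] .
      with y_alt have ya: "y = a @ alt s t (m s t)" by (rule HOL.trans)
      then have "word_prod G y = word_prod G a \<otimes> word_prod G (alt s t (m s t))"
        using y stJ by (subst wp_append[symmetric]) (auto simp: in_lists_conv_set)
      also have "\<dots> = word_prod G ((a @ z) @ [s])"
        unfolding alt_braid[OF s t(2)] z using a(1) z(1) s stJ
        by (subst wp_append[symmetric]) (auto simp: in_lists_conv_set)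
      finally have "word_prod G y = word_prod G ((a @ z) @ [s])" .
      moreover have "length y = Suc (length (a @ z))"
        using a(2) arg_cong[OF z(2), of length] M by simp
      ultimately show False using no_s[of "a @ z"] a(1) z(1) by (auto simp: in_lists_conv_set)
    qed
    have "s \<noteq> t"
    proof
      assume "s = t"
      then show False using less.prems(3) u snoc \<open>w = word_prod G u' \<otimes> t\<close>
        cox_length_le[OF u'] s wp_closed[OF lists_S[OF assms(1) u']] by (simp add: S_cancel_right)
    qed
    have "act w (simple s) = act v (word_refl (alt s t (length y)) (simple s))"
      unfolding y_alt[symmetric] using v(2) act_mult[OF vc] act_word wp_closed lists_S[OF stJ(2) y]
        by simp
    \<comment> \<open>The strict bound on \<open>length y\<close> matters here, because one of the
      coefficients has index \<open>Suc (length y)\<close>.\<close>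
    moreover have "cheb (m s t) (length y) \<ge> 0" "cheb (m s t) (Suc (length y)) \<ge> 0"
      using len m_neq_1[OF s t(2) \<open>s \<noteq> t\<close>] by (auto intro!: cheb_nonneg)
    ultimately show ?thesis
      using word_refl_alt[OF s t(2), of "length y"] IH
      by (simp add: act_lincomb lincomb_nonneg)
  qed
qed

section \<open>Roots, inversions and parabolic parts\<close>

definition roots :: "('a \<Rightarrow> real) set" where
  "roots = {act g (simple s) | g s. g \<in> carrier G \<and> s \<in> S}"

definition pos_roots :: "('a \<Rightarrow> real) set" where
  "pos_roots = {\<beta> \<in> roots. \<forall>x. \<beta> x \<ge> 0}"

definition supported :: "'a set \<Rightarrow> ('a \<Rightarrow> real) set" where
  "supported J = {v. \<forall>x. x \<notin> J \<longrightarrow> v x = 0}"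

definition inv_roots :: "'a \<Rightarrow> ('a \<Rightarrow> real) set" where
  "inv_roots w = {\<beta> \<in> pos_roots. - act (inv w) \<beta> \<in> pos_roots}"

text \<open>Characterised by its action, hence independent of how the root is written as the image
  of a simple root. Uniqueness comes from faithfulness of the action.\<close>

definition root_reflection :: "('a \<Rightarrow> real) \<Rightarrow> 'a" where
  "root_reflection \<beta> = (THE t. t \<in> carrier G \<and> (\<forall>v. act t v = lincomb 1 v (- 2 * form v \<beta>) \<beta>))"

lemma uminus_lincomb: "- v = lincomb (-1) v 0 v"
  by (simp add: lincomb_def fun_eq_iff)

lemma uminus_uminus_fun [simp]: "- (- v) = (v :: 'a \<Rightarrow> real)"
  by (simp add: fun_eq_iff)

lemma act_uminus: "act g (- v) = - act g v"
  by (simp add: uminus_lincomb act_lincomb)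

lemma simple_refl_uminus: "simple_refl s (- v) = - simple_refl s v"
  by (simp add: uminus_lincomb simple_refl_lincomb)

lemma simple_refl_simple_self: "s \<in> S \<Longrightarrow> simple_refl s (simple s) = - simple s"
  by (simp add: uminus_lincomb simple_refl_simple)

lemma act_in_roots: "g \<in> carrier G \<Longrightarrow> \<beta> \<in> roots \<Longrightarrow> act g \<beta> \<in> roots"
proof -
  assume g: "g \<in> carrier G" and "\<beta> \<in> roots"
  then obtain h s where "\<beta> = act h (simple s)" "h \<in> carrier G" "s \<in> S" by (auto simp: roots_def)
  then have "act g \<beta> = act (g \<otimes> h) (simple s)" "g \<otimes> h \<in> carrier G" "s \<in> S"
    using g by (auto simp: act_mult)
  then show ?thesis unfolding roots_def by blast
qed

lemma simple_in_roots: "s \<in> S \<Longrightarrow> simple s \<in> roots"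
  unfolding roots_def by (intro CollectI exI[of _ \<one>] exI[of _ s]) (simp add: act_one)

lemma simple_pos: "s \<in> S \<Longrightarrow> simple s \<in> pos_roots"
  by (simp add: pos_roots_def simple_in_roots) (simp add: simple_def)

lemma pos_roots_roots: "\<beta> \<in> pos_roots \<Longrightarrow> \<beta> \<in> roots"
  and pos_roots_nonneg: "\<beta> \<in> pos_roots \<Longrightarrow> \<beta> x \<ge> 0"
  by (auto simp: pos_roots_def)

lemma act_mult_simple_self:
  "g \<in> carrier G \<Longrightarrow> s \<in> S \<Longrightarrow> act (g \<otimes> s) (simple s) = - act g (simple s)"
  by (simp add: act_mult S_carrier act_simple simple_refl_simple_self act_uminus)

lemma uminus_root: "\<beta> \<in> roots \<Longrightarrow> - \<beta> \<in> roots"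
proof -
  assume "\<beta> \<in> roots"
  then obtain h s where "\<beta> = act h (simple s)" "h \<in> carrier G" "s \<in> S" by (auto simp: roots_def)
  then have "- \<beta> = act (h \<otimes> s) (simple s)" "h \<otimes> s \<in> carrier G" "s \<in> S"
    using S_carrier by (auto simp: act_mult_simple_self)
  then show ?thesis unfolding roots_def by blast
qed

lemma form_root: "\<beta> \<in> roots \<Longrightarrow> form \<beta> \<beta> = 1"
  unfolding roots_def by (auto simp: form_act form_simple_left form_simple_self)

lemma root_support:
  assumes "\<beta> \<in> roots" "x \<notin> S"
  shows "\<beta> x = 0"
proof -
  obtain g s where gs: "\<beta> = act g (simple s)" "g \<in> carrier G" "s \<in> S"
    using assms(1) by (auto simp: roots_def)
  moreover obtain u where u: "u \<in> lists S" "word_prod G u = g"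
    using carrier_word gs by blast
  moreover have "x \<noteq> s" "x \<notin> set u" using gs u assms by auto
  ultimately show ?thesis using word_refl_other[of x u] act_word[OF u(1)]
    by (simp add: simple_other)
qed

text \<open>A descent of \<open>g\<close> is an ascent of \<open>g \<otimes> s\<close>, whose root
  is the negative one; so positivity at ascents yields both signs.\<close>

lemma descent_sign:
  assumes "g \<in> carrier G" "s \<in> S"
  shows "cox_length G S g < cox_length G S (g \<otimes> s) \<Longrightarrow> act g (simple s) \<in> pos_roots"
    and "\<not> cox_length G S g < cox_length G S (g \<otimes> s) \<Longrightarrow> - act g (simple s) \<in> pos_roots"
proof -
  have g: "g \<in> generate G S" and gs: "g \<otimes> s \<in> generate G S"
    using assms S_generates S_carrier by auto
  have r: "act g (simple s) \<in> roots" using assms by (intro act_in_roots simple_in_roots)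
  show "cox_length G S g < cox_length G S (g \<otimes> s) \<Longrightarrow> act g (simple s) \<in> pos_roots"
    using act_simple_nonneg[OF subset_refl g assms(2)] r by (auto simp: pos_roots_def)
  assume "\<not> cox_length G S g < cox_length G S (g \<otimes> s)"
  then have "cox_length G S (g \<otimes> s) < cox_length G S (g \<otimes> s \<otimes> s)"
    using cox_length_mult_simple[OF subset_refl g assms(2)] assms by (auto simp: S_cancel_right)
  then have "act (g \<otimes> s) (simple s) x \<ge> 0" for x
    using act_simple_nonneg[OF subset_refl gs assms(2)] by blast
  then show "- act g (simple s) \<in> pos_roots"
    unfolding act_mult_simple_self[OF assms] using uminus_root[OF r] by (auto simp: pos_roots_def)
qed

lemma root_cases: "\<beta> \<in> roots \<Longrightarrow> \<beta> \<in> pos_roots \<or> - \<beta> \<in> pos_roots"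
  unfolding roots_def using descent_sign by blast

lemma pos_not_neg: "\<beta> \<in> pos_roots \<Longrightarrow> - \<beta> \<notin> pos_roots"
proof
  assume "\<beta> \<in> pos_roots" "- \<beta> \<in> pos_roots"
  then have "\<beta> x = 0" for x using pos_roots_nonneg[of \<beta> x] pos_roots_nonneg[of "- \<beta>" x] by simp
  then show False using form_root[of \<beta>] \<open>\<beta> \<in> pos_roots\<close> pos_roots_roots by (simp add: form_def)
qed

lemma root_pos_coord: "\<beta> \<in> roots \<Longrightarrow> \<beta> x > 0 \<Longrightarrow> \<beta> \<in> pos_roots"
  using root_cases[of \<beta>] pos_roots_nonneg[of "- \<beta>" x] by auto

lemma descent_exists:
  assumes "g \<in> carrier G" "g \<noteq> \<one>"
  shows "\<exists>s\<in>S. - act g (simple s) \<in> pos_roots"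
proof -
  have "g \<in> generate G S" using assms S_generates by simp
  then obtain u where u: "u \<in> lists S" "word_prod G u = g" "length u = cox_length G S g"
    using reduced_exists[OF subset_refl] by metis
  then obtain u' s where us: "u = u' @ [s]" using assms by (cases u rule: rev_cases) auto
  then have s: "s \<in> S" "u' \<in> lists S" using u by auto
  have "g = word_prod G u' \<otimes> s"
    using u(2) us s(1) S_carrier wp_append[OF s(2), of "[s]"] by simp
  then have "g \<otimes> s = word_prod G u'"
    using S_cancel_right[OF s(1) wp_closed[OF s(2)]] by simp
  then have "\<not> cox_length G S g < cox_length G S (g \<otimes> s)"
    using cox_length_le[OF s(2)] u us by auto
  then show ?thesis using descent_sign(2)[OF assms(1) s(1)] s by blast
qed

text \<open>A nontrivial element makes some simple root negative, so it cannot fix all of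
  them.\<close>

lemma act_faithful:
  assumes "g \<in> carrier G" "h \<in> carrier G" "\<And>s. s \<in> S \<Longrightarrow> act g (simple s) = act h (simple s)"
  shows "g = h"
proof -
  have "act (inv g \<otimes> h) (simple s) = simple s" if "s \<in> S" for s
    using assms that by (simp add: act_mult flip: assms(3)) (simp add: act_inv)
  then have "inv g \<otimes> h = \<one>"
    using descent_exists[of "inv g \<otimes> h"] pos_not_neg simple_pos assms by auto
  then show ?thesis using assms by (metis inv_closed inv_equality inv_inv)
qed

lemma act_reflection:
  assumes "g \<in> carrier G" "s \<in> S"
  shows "act (g \<otimes> s \<otimes> inv g) v =
    lincomb 1 v (- 2 * form v (act g (simple s))) (act g (simple s))"
proof -
  have "act (g \<otimes> s \<otimes> inv g) v = act g (simple_refl s (act (inv g) v))"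
    using assms S_carrier by (simp add: act_mult act_simple)
  also have "\<dots> = lincomb 1 v (- 2 * form_simple s (act (inv g) v)) (act g (simple s))"
    using assms by (simp add: simple_refl_def act_lincomb act_inv')
  also have "form_simple s (act (inv g) v) = form v (act g (simple s))"
    using form_act[OF assms(1), of "act (inv g) v" "simple s"] assms
      by (simp add: form_simple_right act_inv')
  finally show ?thesis .
qed

lemma root_reflection_act:
  assumes "g \<in> carrier G" "s \<in> S"
  shows "root_reflection (act g (simple s)) = g \<otimes> s \<otimes> inv g"
  unfolding root_reflection_def
proof (rule the_equality)
  show "t = g \<otimes> s \<otimes> inv g"
    if "t \<in> carrier G \<and> (\<forall>v. act t v = lincomb 1 v (- 2 * form v (act g (simple s))) (act g (simple s)))" for t
    using that assms S_carrier by (intro act_faithful) (auto simp: act_reflection)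
qed (use assms S_carrier act_reflection in auto)

lemma root_reflection_simple: "s \<in> S \<Longrightarrow> root_reflection (simple s) = s"
  using root_reflection_act[of \<one> s] S_carrier by (simp add: act_one)

lemma root_reflection:
  assumes "\<beta> \<in> roots"
  shows "root_reflection \<beta> \<in> carrier G" and
    "act (root_reflection \<beta>) v = lincomb 1 v (- 2 * form v \<beta>) \<beta>"
    and "act (root_reflection \<beta>) \<beta> = - \<beta>" and "inv (root_reflection \<beta>) = root_reflection \<beta>"
proof -
  obtain g s where gs: "\<beta> = act g (simple s)" "g \<in> carrier G" "s \<in> S"
    using assms by (auto simp: roots_def)
  show "root_reflection \<beta> \<in> carrier G" "act (root_reflection \<beta>) v = lincomb 1 v (- 2 * form v \<beta>) \<beta>"
    using gs S_carrier by (auto simp: root_reflection_act act_reflection)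
  show "inv (root_reflection \<beta>) = root_reflection \<beta>"
    using gs S_carrier by (simp add: root_reflection_act inv_mult_group S_inv m_assoc)
  have "act (root_reflection \<beta>) \<beta> = lincomb 1 \<beta> (- 2 * form \<beta> \<beta>) \<beta>"
    using gs S_carrier by (auto simp: root_reflection_act act_reflection)
  then show "act (root_reflection \<beta>) \<beta> = - \<beta>"
    using form_root[OF assms] by (simp add: lincomb_def fun_eq_iff)
qed

text \<open>All roots have norm 1, so the factor is 1 or -1, and positivity rules out -1.\<close>

lemma pos_proportional:
  assumes "\<beta> \<in> pos_roots" "\<gamma> \<in> pos_roots" "\<And>x. \<beta> x = c * \<gamma> x"
  shows "\<beta> = \<gamma>"
proof -
  have \<beta>: "\<beta> = lincomb c \<gamma> 0 \<gamma>" using assms(3) by (simp add: lincomb_def fun_eq_iff)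
  have "form \<beta> \<beta> = c * c * form \<gamma> \<gamma>" unfolding \<beta> by (simp add: form_lc_left form_lc_right)
  then have "c * c = 1" using assms form_root pos_roots_roots by simp
  then have "c = 1 \<or> c = -1" by (simp add: square_eq_1_iff)
  moreover have "c \<noteq> -1"
  proof
    assume "c = -1"
    then have "- \<gamma> = \<beta>" using assms(3) by (auto simp: fun_eq_iff)
    then show False using pos_not_neg assms by blast
  qed
  ultimately show ?thesis using assms(3) by (auto simp: fun_eq_iff)
qed

text \<open>A common reflection negates both roots; comparing this with the formula for the second
  reflection makes the first root a multiple of the second.\<close>

lemma root_reflection_inj: "inj_on root_reflection pos_roots"
proof (rule inj_onI)
  fix \<beta> \<gamma> assume *: "\<beta> \<in> pos_roots" "\<gamma> \<in> pos_roots" "root_reflection \<beta> = root_reflection \<gamma>"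
  have "- \<beta> = lincomb 1 \<beta> (- 2 * form \<beta> \<gamma>) \<gamma>"
    using root_reflection(2)[of \<gamma> \<beta>] root_reflection(3)[of \<beta>] * pos_roots_roots by simp
  then have "\<beta> x = form \<beta> \<gamma> * \<gamma> x" for x
    by (auto simp: lincomb_def fun_eq_iff dest!: spec[of _ x])
  then show "\<beta> = \<gamma>" using pos_proportional * by blast
qed

lemma simple_refl_in_roots: "s \<in> S \<Longrightarrow> \<beta> \<in> roots \<Longrightarrow> simple_refl s \<beta> \<in> roots"
  using act_in_roots[of s \<beta>] S_carrier by (simp add: act_simple)

lemma pos_root_other_coord:
  assumes "s \<in> S" "\<beta> \<in> pos_roots" "\<beta> \<noteq> simple s"
  shows "\<exists>x. x \<noteq> s \<and> \<beta> x > 0"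
proof (rule ccontr)
  assume "\<not> ?thesis"
  then have "\<beta> x = \<beta> s * simple s x" for x
    using pos_roots_nonneg[OF assms(2), of x]
      by (cases "x = s") (auto simp: simple_other order_le_less)
  then show False using pos_proportional[OF assms(2) simple_pos[OF assms(1)]] assms(3) by blast
qed

text \<open>The reflection changes the coordinate at \<open>s\<close> only. Some other positive
  coordinate survives, and the coordinates of a root all have one sign.\<close>

lemma simple_refl_pos:
  assumes "s \<in> S" "\<beta> \<in> pos_roots" "\<beta> \<noteq> simple s"
  shows "simple_refl s \<beta> \<in> pos_roots"
proof -
  obtain x where "x \<noteq> s" "\<beta> x > 0" using pos_root_other_coord[OF assms] by blast
  then show ?thesis
    using root_pos_coord[of "simple_refl s \<beta>" x] simple_refl_in_roots assms pos_roots_roots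
      by (simp add: simple_refl_other)
qed

lemma simple_refl_ne_simple: "s \<in> S \<Longrightarrow> \<beta> \<in> pos_roots \<Longrightarrow> simple_refl s \<beta> \<noteq> simple s"
  by (metis pos_not_neg simple_refl_simple_refl simple_refl_simple_self simple_pos uminus_root)

section \<open>Inversion sets as sets of positive roots\<close>

lemma not_inv_roots: 
  assumes "w \<in> carrier G" "\<beta> \<in> pos_roots"
  shows "\<beta> \<notin> inv_roots w \<longleftrightarrow> act (inv w) \<beta> \<in> pos_roots"
  using root_cases[OF act_in_roots[OF inv_closed[OF assms(1)] pos_roots_roots[OF assms(2)]]]
    assms(2) pos_not_neg unfolding inv_roots_def by auto

lemma inv_roots_pos: "\<beta> \<in> inv_roots w \<Longrightarrow> \<beta> \<in> pos_roots"
  by (simp add: inv_roots_def)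

lemma inv_roots_one: "inv_roots \<one> = {}"
  using pos_not_neg by (auto simp: inv_roots_def act_one)

text \<open>\<open>simple_refl s\<close> permutes the positive roots other than
  \<open>simple s\<close>, so the inversions are carried along and only \<open>simple s\<close> is
  new.\<close>

lemma inv_roots_mult_up:
  assumes "s \<in> S" "w \<in> carrier G" "simple s \<notin> inv_roots w"
  shows "inv_roots (s \<otimes> w) = insert (simple s) (simple_refl s ` inv_roots w)"
proof -
  have a: "act (inv (s \<otimes> w)) \<beta> = act (inv w) (simple_refl s \<beta>)" for \<beta>
    using assms S_carrier by (simp add: inv_mult_group S_inv act_mult act_simple)
  have s: "simple s \<in> inv_roots (s \<otimes> w)"
    using not_inv_roots[OF assms(2) simple_pos[OF assms(1)]] assms
    by (auto simp: inv_roots_def a simple_pos simple_refl_simple_self act_uminus)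
  have "\<beta> \<in> inv_roots (s \<otimes> w) \<longleftrightarrow> simple_refl s \<beta> \<in> inv_roots w" if "\<beta> \<in> pos_roots"
    "\<beta> \<noteq> simple s" for \<beta>
    using that simple_refl_pos[OF assms(1) that] by (simp add: inv_roots_def a)
  moreover have "simple_refl s \<beta> \<in> pos_roots \<and> simple_refl s \<beta> \<noteq> simple s" if
    "\<beta> \<in> inv_roots w" for \<beta>
    using that assms inv_roots_pos simple_refl_pos simple_refl_ne_simple by metis
  ultimately show ?thesis using s inv_roots_pos
    by (auto simp: simple_refl_simple_refl[OF assms(1)]) (metis assms(1) image_eqI simple_refl_simple_refl)
qed

lemma inv_roots_mult_down:
  assumes "s \<in> S" "w \<in> carrier G" "simple s \<in> inv_roots w"
  shows "simple s \<notin> inv_roots (s \<otimes> w)" and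
    "inv_roots w = insert (simple s) (simple_refl s ` inv_roots (s \<otimes> w))"
proof -
  have a: "act (inv (s \<otimes> w)) \<beta> = act (inv w) (simple_refl s \<beta>)" for \<beta>
    using assms S_carrier by (simp add: inv_mult_group S_inv act_mult act_simple)
  show *: "simple s \<notin> inv_roots (s \<otimes> w)"
    using assms pos_not_neg[of "- act (inv w) (simple s)"]
    by (auto simp: inv_roots_def a simple_refl_simple_self act_uminus)
  show "inv_roots w = insert (simple s) (simple_refl s ` inv_roots (s \<otimes> w))"
    using inv_roots_mult_up[OF assms(1) _ *] assms S_carrier by (simp add: S_cancel)
qed

lemma inv_roots_simple: "s \<in> S \<Longrightarrow> inv_roots s = {simple s}"
  using inv_roots_mult_up[of s \<one>] S_carrier by (simp add: inv_roots_one)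

text \<open>The exchange condition for roots: when the letters are applied one by one, an inversion
  has to change sign at some letter, and at that moment it is the simple root of that
  letter.\<close>

lemma inv_roots_exchange:
  "u \<in> lists S \<Longrightarrow> \<beta> \<in> inv_roots (word_prod G u) \<Longrightarrow> \<exists>a r c. u = a @ r # c \<and> \<beta> = word_refl a (simple r)"
proof (induction u arbitrary: \<beta>)
  case Nil
  then show ?case by (simp add: inv_roots_one)
next
  case (Cons s u)
  then have s: "s \<in> S" "u \<in> lists S" by auto
  then have w: "word_prod G u \<in> carrier G" using wp_closed by blast
  show ?case
  proof (cases "\<beta> = simple s")
    case True
    then show ?thesis by (intro exI[of _ "[]"]) auto
  next
    case False
    have \<beta>: "\<beta> \<in> pos_roots" using Cons.prems inv_roots_pos by blast
    have "simple_refl s \<beta> \<in> inv_roots (word_prod G u)"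
      using Cons.prems s w S_carrier simple_refl_pos[OF s(1) \<beta> False]
      by (simp add: inv_roots_def inv_mult_group S_inv act_mult act_simple)
    then obtain a r c where "u = a @ r # c" "simple_refl s \<beta> = word_refl a (simple r)"
      using Cons.IH s by blast
    then show ?thesis using simple_refl_simple_refl[OF s(1), of \<beta>] by (intro exI[of _ "s # a"]) auto
  qed
qed

lemma finite_inv_roots:
  assumes "w \<in> carrier G"
  shows "finite (inv_roots w)"
proof -
  obtain u where u: "u \<in> lists S" "word_prod G u = w" using carrier_word assms by blast
  have "inv_roots w \<subseteq> (\<lambda>i. word_refl (take i u) (simple (u ! i))) ` {..<length u}"
  proof
    fix \<beta> assume "\<beta> \<in> inv_roots w"
    then obtain a r c where "u = a @ r # c" "\<beta> = word_refl a (simple r)" using inv_roots_exchange u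
      by blast
    then show "\<beta> \<in> (\<lambda>i. word_refl (take i u) (simple (u ! i))) ` {..<length u}"
      by (intro image_eqI[of _ _ "length a"]) auto
  qed
  then show ?thesis using finite_surj by blast
qed

text \<open>If \<open>v \<noteq> w\<close>, then \<open>inv w \<otimes> v\<close> makes some
  \<open>simple s\<close> negative. The positive one of the two roots
  \<open>act v (simple s)\<close> and its negative is then an inversion of exactly one of
  \<open>v\<close> and \<open>w\<close>.\<close>

lemma inv_roots_inj:
  assumes "v \<in> carrier G" "w \<in> carrier G" "inv_roots v = inv_roots w"
  shows "v = w"
proof (rule ccontr)
  assume "v \<noteq> w"
  then have "inv w \<otimes> v \<noteq> \<one>"
    using assms by (metis inv_closed inv_equality inv_inv)
  then obtain s where s: "s \<in> S" "- act (inv w \<otimes> v) (simple s) \<in> pos_roots"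
    using descent_exists[of "inv w \<otimes> v"] assms by auto
  then have neg: "- act (inv w) (act v (simple s)) \<in> pos_roots" using assms by (simp add: act_mult)
  have r: "act v (simple s) \<in> roots" using assms s by (intro act_in_roots simple_in_roots)
  then consider "act v (simple s) \<in> pos_roots" | "- act v (simple s) \<in> pos_roots"
    using root_cases by blast
  then show False
  proof cases
    case 1
    then have "act v (simple s) \<in> inv_roots v" using neg assms by (simp add: inv_roots_def)
    then have "- simple s \<in> pos_roots" using assms by (simp add: inv_roots_def act_inv)
    then show False using pos_not_neg simple_pos s by blast
  next
    case 2
    then have "- act v (simple s) \<in> inv_roots v" 
      using assms(1) s simple_pos by (simp add: inv_roots_def act_uminus act_inv)
    then have "- act v (simple s) \<in> inv_roots w" using assms(3) by simp
    then have "act (inv w) (act v (simple s)) \<in> pos_roots" by (simp add: inv_roots_def act_uminus)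
    then show False using neg pos_not_neg by blast
  qed
qed

lemma act_generate_other:
  assumes "J \<subseteq> S" "w \<in> generate G J" "x \<notin> J"
  shows "act w v x = v x"
proof -
  obtain u where u: "u \<in> lists J" "word_prod G u = w" using generate_word[OF assms(1,2)] by blast
  then have "x \<notin> set u" using assms(3) by auto
  then show ?thesis using word_refl_other act_word[OF lists_S[OF assms(1) u(1)]] u(2) by simp
qed

lemma act_generate_supported:
  "J \<subseteq> S \<Longrightarrow> w \<in> generate G J \<Longrightarrow> v \<in> supported J \<Longrightarrow> act w v \<in> supported J"
  by (simp add: supported_def act_generate_other)



text \<open>Elements of the parabolic subgroup leave the coordinates outside \<open>J\<close> alone,
  so for an inversion these are both nonnegative and nonpositive.\<close>

lemma inv_roots_supported:
  assumes "J \<subseteq> S" "w \<in> generate G J"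
  shows "inv_roots w \<subseteq> supported J"
proof
  fix \<beta> assume \<beta>: "\<beta> \<in> inv_roots w"
  have "\<beta> x = 0" if "x \<notin> J" for x
  proof -
    have "act (inv w) \<beta> x = \<beta> x"
      by (rule act_generate_other[OF assms(1) generate_inv[OF assms] that])
    then show ?thesis using \<beta> pos_roots_nonneg[of \<beta> x] pos_roots_nonneg[of "- act (inv w) \<beta>" x]
      by (auto simp: inv_roots_def)
  qed
  then show "\<beta> \<in> supported J" by (simp add: supported_def)
qed

lemma act_expand:
  assumes "finite K"
  shows "v \<in> supported K \<Longrightarrow> act g v x = (\<Sum>j\<in>K. v j * act g (simple j) x)"
  using assms
proof (induction K arbitrary: v rule: finite_induct)
  case empty
  then have "v = lincomb 0 v 0 v" by (auto simp: supported_def lincomb_def)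
  then have "act g v = lincomb 0 (act g v) 0 (act g v)" by (metis act_lincomb)
  then show ?case by (metis add_0 lincomb_def mult_zero_left sum.empty)
next
  case (insert k K)
  define v' where "v' = v(k := 0)"
  have v: "v = lincomb 1 v' (v k) (simple k)"
    by (auto simp: v'_def lincomb_def simple_def fun_eq_iff)
  have "v' \<in> supported K" using insert.prems by (auto simp: supported_def v'_def)
  then have "act g v' x = (\<Sum>j\<in>K. v' j * act g (simple j) x)" by (rule insert.IH)
  also have "\<dots> = (\<Sum>j\<in>K. v j * act g (simple j) x)"
    using insert.hyps by (intro sum.cong) (auto simp: v'_def)
  finally have "act g (lincomb 1 v' (v k) (simple k)) x =
      (\<Sum>j\<in>K. v j * act g (simple j) x) + v k * act g (simple k) x"
    unfolding act_lincomb by (simp add: lincomb_def)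
  then show ?case using insert.hyps by (simp flip: v)
qed

lemma act_pos_supported:
  assumes "K \<subseteq> S" "g \<in> carrier G" "\<And>j. j \<in> K \<Longrightarrow> act g (simple j) \<in> pos_roots"
    and "\<beta> \<in> pos_roots" "\<beta> \<in> supported K"
  shows "act g \<beta> \<in> pos_roots"
proof -
  have "finite K" using assms finite_S finite_subset by blast
  then have "act g \<beta> x \<ge> 0" for x
    using act_expand[OF _ assms(5), of g x] assms pos_roots_nonneg
    by (auto intro!: sum_nonneg mult_nonneg_nonneg)
  then show ?thesis
    using act_in_roots[OF assms(2) pos_roots_roots[OF assms(4)]] by (simp add: pos_roots_def)
qed

text \<open>The letter is deleted from a reduced word over \<open>J\<close>, so that the drop
  concerns the length function of the parabolic subgroup, to which \<open>inversions G J\<close>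
  refers.\<close>

lemma deletion:
  assumes "J \<subseteq> S" "w \<in> generate G J" "\<beta> \<in> inv_roots w"
  shows "root_reflection \<beta> \<in> reflections G J" and "root_reflection \<beta> \<in> generate G J"
    and "cox_length G J (root_reflection \<beta> \<otimes> w) < cox_length G J w"
proof -
  obtain u where u: "u \<in> lists J" "word_prod G u = w" "length u = cox_length G J w"
    using reduced_exists[OF assms(1,2)] .
  have "\<exists>a r c. u = a @ r # c \<and> \<beta> = word_refl a (simple r)"
    using inv_roots_exchange[OF lists_S[OF assms(1) u(1)], of \<beta>] assms(3) unfolding u(2) .
  then obtain a r c where arc: "u = a @ r # c" "\<beta> = word_refl a (simple r)" by blast
  have a: "a \<in> lists J" "a \<in> lists S" and r: "r \<in> J" "r \<in> S" and c: "c \<in> lists J" "c \<in> lists S"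
    using arc u assms(1) by auto
  have \<beta>: "root_reflection \<beta> = word_prod G a \<otimes> r \<otimes> inv (word_prod G a)"
    using root_reflection_act[OF wp_closed r(2), of a] a arc by (simp add: act_word)
  then show 1: "root_reflection \<beta> \<in> reflections G J"
    using a r wp_in_generate[OF assms(1)] unfolding reflections_def by blast
  show "root_reflection \<beta> \<in> generate G J"
    unfolding \<beta> using assms(1) a r 
    by (intro generate_mult generate_inv wp_in_generate generate_simple)
  have w: "w = word_prod G a \<otimes> (r \<otimes> word_prod G c)"
    using u(2) arc(1) wp_append[OF a(2), of "r # c"] r c by simp
  have "inv (word_prod G a) \<otimes> (word_prod G a \<otimes> x) = x" if "x \<in> carrier G" for x
    using that wp_closed[OF a(2)] by (metis inv_closed l_inv l_one m_assoc)
  then have "root_reflection \<beta> \<otimes> w = word_prod G (a @ c)"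
    unfolding \<beta> w using wp_closed[OF a(2)] wp_closed[OF c(2)] S_carrier[OF r(2)] S_cancel[OF r(2)]
    by (simp add: m_assoc wp_append a c)
  then show "cox_length G J (root_reflection \<beta> \<otimes> w) < cox_length G J w"
    using cox_length_le[of "a @ c" J] a c u(3) arc(1) by simp
qed

lemma reflections_generate: "J \<subseteq> S \<Longrightarrow> t \<in> reflections G J \<Longrightarrow> t \<in> generate G J"
  unfolding reflections_def
  by clarify (rule generate_mult[OF generate_mult[OF _ generate_simple] generate_inv])

lemma root_reflection_image_subset:
  "A \<subseteq> pos_roots \<Longrightarrow> C \<subseteq> pos_roots \<Longrightarrow> root_reflection ` A \<subseteq> root_reflection ` C \<longleftrightarrow> A \<subseteq> C"
  using root_reflection_inj unfolding inj_on_def by blast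

lemma inv_roots_pos_subset: "inv_roots w \<subseteq> pos_roots"
  using inv_roots_pos by blast

lemma reflection_root:
  assumes "J \<subseteq> S" "t \<in> reflections G J"
  shows "\<exists>\<beta>\<in>pos_roots. t = root_reflection \<beta>"
proof -
  obtain g s where gs: "g \<in> generate G J" "s \<in> J" "t = g \<otimes> s \<otimes> inv g"
    using assms by (auto simp: reflections_def)
  then have g: "g \<in> carrier G" "s \<in> S" "s \<in> carrier G"
    using assms generate_carrier S_carrier by auto
  have "t = root_reflection (act g (simple s))" using root_reflection_act g gs by simp
  moreover have "t = root_reflection (- act g (simple s))"
    using root_reflection_act[of "g \<otimes> s" s] g gs 
    by (simp add: act_mult_simple_self inv_mult_group S_inv m_assoc S_cancel)
  moreover have "act g (simple s) \<in> roots" using g by (intro act_in_roots simple_in_roots)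
  ultimately show ?thesis using root_cases by blast
qed

text \<open>One inclusion is deletion. For the other: if the root of \<open>t\<close> is not
  inverted by \<open>w\<close>, it is inverted by \<open>t \<otimes> w\<close>, and deletion applied
  there makes \<open>t \<otimes> w\<close> longer than \<open>w\<close>.\<close>

lemma inversions_eq:
  assumes "J \<subseteq> S" "w \<in> generate G J"
  shows "inversions G J w = root_reflection ` inv_roots w"
proof (intro equalityI subsetI)
  fix t assume t: "t \<in> inversions G J w"
  then have tJ: "t \<in> reflections G J" and less: "cox_length G J (t \<otimes> w) < cox_length G J w"
    by (auto simp: inversions_def)
  then obtain \<beta> where \<beta>: "\<beta> \<in> pos_roots" "t = root_reflection \<beta>" using reflection_root assms
    by blast
  have w: "w \<in> carrier G" using assms generate_carrier by blast
  have r: "\<beta> \<in> roots" using \<beta> pos_roots_roots by blast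
  have tW: "t \<in> generate G J"
    using tJ assms(1) reflections_generate by blast
  have "\<beta> \<in> inv_roots w"
  proof (rule ccontr)
    assume "\<beta> \<notin> inv_roots w"
    then have "act (inv w) \<beta> \<in> pos_roots" using not_inv_roots[OF w \<beta>(1)] by simp
    then have "\<beta> \<in> inv_roots (t \<otimes> w)"
      using w r \<beta> root_reflection[OF r]
        by (simp add: inv_roots_def inv_mult_group act_mult act_uminus)
    then have "cox_length G J (t \<otimes> (t \<otimes> w)) < cox_length G J (t \<otimes> w)"
      using deletion(3)[OF assms(1) generate_mult[OF tW assms(2)]] \<beta> by simp
    moreover have "t \<otimes> (t \<otimes> w) = w"
      using root_reflection[OF r] w \<beta>(2) by (metis inv_closed l_inv l_one m_assoc)
    ultimately show False using less by simp
  qed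
  then show "t \<in> root_reflection ` inv_roots w" using \<beta> by blast
next
  fix t assume "t \<in> root_reflection ` inv_roots w"
  then show "t \<in> inversions G J w" using deletion[OF assms] by (auto simp: inversions_def)
qed

lemma weak_le_iff:
  assumes "J \<subseteq> S"
  shows "weak_le G J v w \<longleftrightarrow> v \<in> generate G J \<and> w \<in> generate G J \<and> inv_roots v \<subseteq> inv_roots w"
  unfolding weak_le_def
  using inversions_eq[OF assms] root_reflection_image_subset[OF inv_roots_pos_subset inv_roots_pos_subset, of v w]
  by (cases "v \<in> generate G J \<and> w \<in> generate G J") auto

lemma weak_le_simple_iff:
  assumes "J \<subseteq> S" "s \<in> J" "w \<in> generate G J"
  shows "weak_le G J s w \<longleftrightarrow> simple s \<in> inv_roots w"
  using assms inv_roots_simple[of s] by (auto simp: weak_le_iff generate_simple)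

text \<open>Take \<open>z\<close> of least length in the coset of \<open>w\<close>. Its inverse
  keeps the simple roots of \<open>K\<close> positive, hence all positive roots supported on
  \<open>K\<close>; so on such roots the sign under \<open>inv w\<close> is decided by
  \<open>v\<close> alone.\<close>

lemma parabolic_factor:
  assumes "K \<subseteq> S" "w \<in> carrier G"
  obtains v z where "v \<in> generate G K" "z \<in> carrier G" "w = v \<otimes> z"
    "\<And>j. j \<in> K \<Longrightarrow> act (inv z) (simple j) \<in> pos_roots"
    "inv_roots v = inv_roots w \<inter> supported K"
proof -
  define P where "P z \<longleftrightarrow> z \<in> carrier G \<and> (\<exists>v\<in>generate G K. w = v \<otimes> z)" for z
  have "P w" unfolding P_def using assms generate.one[of G K] by force
  then obtain z where z: "P z" and min: "\<And>y. P y \<Longrightarrow> cox_length G S z \<le> cox_length G S y"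
    using ex_has_least_nat[of P w "cox_length G S"] by blast
  then obtain v where v: "v \<in> generate G K" "w = v \<otimes> z" "z \<in> carrier G" by (auto simp: P_def)
  have vc: "v \<in> carrier G" using v assms generate_carrier by blast
  have j: "act (inv z) (simple j) \<in> pos_roots" if "j \<in> K" for j
  proof (rule ccontr)
    assume neg: "\<not> ?thesis"
    have jS: "j \<in> S" "j \<in> carrier G" using that assms S_carrier by auto
    then have "simple j \<in> inv_roots z" using not_inv_roots[OF v(3) simple_pos[of j]] neg by blast
    then have "cox_length G S (root_reflection (simple j) \<otimes> z) < cox_length G S z"
      using deletion(3)[of S z] v S_generates by simp
    moreover have "root_reflection (simple j) = j"
      using jS by (simp add: root_reflection_simple)
    moreover have "P (j \<otimes> z)"
      unfolding P_def
    proof (intro conjI bexI)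
      show "w = (v \<otimes> j) \<otimes> (j \<otimes> z)" using v vc jS by (simp add: m_assoc S_cancel)
      show "v \<otimes> j \<in> generate G K" using generate_mult[OF v(1) generate_simple[OF that]] .
    qed (use v jS in auto)
    ultimately show False using min[of "j \<otimes> z"] by simp
  qed
  have pos: "act (inv z) \<beta> \<in> pos_roots" if "\<beta> \<in> pos_roots" "\<beta> \<in> supported K" for \<beta>
    using act_pos_supported[OF assms(1) _ j that] v by simp
  have aw: "act (inv w) \<beta> = act (inv z) (act (inv v) \<beta>)" for \<beta>
    using v vc by (simp add: inv_mult_group act_mult)
  have sup: "act (inv v) \<beta> \<in> supported K" if "\<beta> \<in> supported K" for \<beta>
    using act_generate_supported[OF assms(1) generate_inv[OF assms(1) v(1)] that] .
  have "inv_roots v = inv_roots w \<inter> supported K"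
  proof (intro equalityI subsetI)
    fix \<beta> assume \<beta>: "\<beta> \<in> inv_roots v"
    then have \<beta>K: "\<beta> \<in> supported K" using inv_roots_supported[OF assms(1) v(1)] by blast
    then have "- act (inv v) \<beta> \<in> supported K" using sup by (auto simp: supported_def)
    then have "- act (inv w) \<beta> \<in> pos_roots"
      using pos[of "- act (inv v) \<beta>"] \<beta> by (simp add: inv_roots_def aw act_uminus)
    then show "\<beta> \<in> inv_roots w \<inter> supported K" using \<beta> \<beta>K by (simp add: inv_roots_def)
  next
    fix \<beta> assume \<beta>: "\<beta> \<in> inv_roots w \<inter> supported K"
    show "\<beta> \<in> inv_roots v"
    proof (rule ccontr)
      assume "\<beta> \<notin> inv_roots v"
      then have "act (inv v) \<beta> \<in> pos_roots" using not_inv_roots[OF vc] \<beta> inv_roots_pos by blast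
      then have "act (inv w) \<beta> \<in> pos_roots" unfolding aw using pos sup \<beta> by simp
      then show False using \<beta> pos_not_neg by (auto simp: inv_roots_def)
    qed
  qed
  then show ?thesis using that v j by blast
qed

lemma parabolic_part:
  assumes "J \<subseteq> S" "K \<subseteq> J" "w \<in> generate G J"
  shows "parabolic_part G J K w \<in> generate G K"
    and "inv_roots (parabolic_part G J K w) = inv_roots w \<inter> supported K"
proof -
  have KS: "K \<subseteq> S" using assms by auto
  obtain v where v: "v \<in> generate G K" "inv_roots v = inv_roots w \<inter> supported K"
    using parabolic_factor[OF KS generate_carrier[OF assms(1,3)]] by metis
  \<comment> \<open>The reflection negates its root, yet as an element of the parabolic subgroup it
    fixes the coordinates outside \<open>K\<close>; these must vanish.\<close>
  have sup: "\<beta> \<in> supported K" if "\<beta> \<in> inv_roots w" "root_reflection \<beta> \<in> generate G K" for \<beta>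
  proof -
    have "act (root_reflection \<beta>) \<beta> = - \<beta>"
      using root_reflection(3) pos_roots_roots inv_roots_pos that by blast
    then show ?thesis using act_generate_other[OF KS that(2), of _ \<beta>]
      by (force simp: supported_def)
  qed
  have iff: "inversions G J v' = inversions G J w \<inter> generate G K \<longleftrightarrow> inv_roots v' = inv_roots w \<inter> supported K"
    if "v' \<in> generate G K" for v'
  proof -
    have "inversions G J w \<inter> generate G K = root_reflection ` (inv_roots w \<inter> supported K)"
      unfolding inversions_eq[OF assms(1,3)]
      using sup deletion(2)[OF KS v(1)] v(2) by auto
    moreover have "inversions G J v' = root_reflection ` inv_roots v'"
      using inversions_eq[OF assms(1) generate_mono[OF assms(2) that]] .
    moreover have "inv_roots w \<inter> supported K \<subseteq> pos_roots" using inv_roots_pos_subset by blast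
    ultimately show ?thesis
      using inj_on_image_eq_iff[OF root_reflection_inj inv_roots_pos_subset] by simp
  qed
  have "parabolic_part G J K w = v"
    unfolding parabolic_part_def
  proof (rule the_equality)
    show "v \<in> generate G K \<and> inversions G J v = inversions G J w \<inter> generate G K"
      using v iff by blast
    show "v' = v" if
      "v' \<in> generate G K \<and> inversions G J v' = inversions G J w \<inter> generate G K" for v'
      using that iff v inv_roots_inj generate_carrier[OF KS] by metis
  qed
  then show "parabolic_part G J K w \<in> generate G K"
    and "inv_roots (parabolic_part G J K w) = inv_roots w \<inter> supported K" using v by auto
qed

section \<open>The Euler form of a Coxeter word\<close>

text \<open>For a word without repetitions over \<open>S\<close>, this is minus the form of
  \<open>simple s\<close> with the part of \<beta> on the letters of \<open>u\<close>. The sign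
  makes it nonnegative for nonnegative \<beta> when \<open>s\<close> is not in
  \<open>u\<close>.\<close>

definition flow :: "'a \<Rightarrow> 'a list \<Rightarrow> ('a \<Rightarrow> real) \<Rightarrow> real" where
  "flow s u \<beta> = (\<Sum>r\<leftarrow>u. - form_entry s r * \<beta> r)"

text \<open>On a word without repetitions over \<open>S\<close> the matrix is triangular: 1 on the
  diagonal and \<open>2 * form_entry s r\<close> if \<open>s\<close> stands before \<open>r\<close>,
  so symmetrising gives twice the form. In the simply-laced case it is the Euler form of the quiver
  with arrows directed along the word.\<close>

primrec euler :: "'a list \<Rightarrow> ('a \<Rightarrow> real) \<Rightarrow> ('a \<Rightarrow> real) \<Rightarrow> real" where
  "euler [] \<beta> \<gamma> = 0"
| "euler (s # u) \<beta> \<gamma> = euler u \<beta> \<gamma> + \<beta> s * (\<gamma> s - 2 * flow s u \<gamma>)"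

lemma flow_Nil [simp]: "flow s [] \<beta> = 0"
  and flow_Cons [simp]: "flow s (r # u) \<beta> = flow s u \<beta> - form_entry s r * \<beta> r"
  and flow_append: "flow s (u @ u') \<beta> = flow s u \<beta> + flow s u' \<beta>"
  by (simp_all add: flow_def)

lemma flow_cong: "(\<And>x. x \<in> set u \<Longrightarrow> \<beta> x = \<gamma> x) \<Longrightarrow> flow s u \<beta> = flow s u \<gamma>"
  by (induction u) auto

lemma flow_set: "distinct u \<Longrightarrow> flow s u \<beta> = (\<Sum>r\<in>set u. - form_entry s r * \<beta> r)"
  unfolding flow_def by (rule sum_list_distinct_conv_sum_set)

lemma euler_cong:
  "(\<And>x. x \<in> set u \<Longrightarrow> \<beta> x = \<beta>' x) \<Longrightarrow> (\<And>x. x \<in> set u \<Longrightarrow> \<gamma> x = \<gamma>' x) \<Longrightarrow>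
    euler u \<beta> \<gamma> = euler u \<beta>' \<gamma>'"
proof (induction u)
  case (Cons s u)
  then show ?case using flow_cong[of u \<gamma> \<gamma>' s] by auto
qed simp

lemma euler_snoc:
  "set u \<subseteq> S \<Longrightarrow> s \<in> S \<Longrightarrow>
    euler (u @ [s]) \<beta> \<gamma> = euler u \<beta> \<gamma> + (\<beta> s - 2 * flow s u \<beta>) * \<gamma> s"
  by (induction u) (auto simp: flow_append form_entry_sym algebra_simps)

lemma euler_zero_left: "(\<And>x. x \<in> set u \<Longrightarrow> \<beta> x = 0) \<Longrightarrow> euler u \<beta> \<gamma> = 0"
  by (induction u) auto

lemma flow_zero: "(\<And>x. x \<in> set u \<Longrightarrow> \<beta> x = 0) \<Longrightarrow> flow s u \<beta> = 0"
  by (induction u) auto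

lemma euler_zero_right: "(\<And>x. x \<in> set u \<Longrightarrow> \<gamma> x = 0) \<Longrightarrow> euler u \<beta> \<gamma> = 0"
  by (induction u) (auto simp: flow_zero)

lemma form_simple_flow:
  assumes "distinct (s # u)" "set (s # u) \<subseteq> S" "\<beta> \<in> supported (set (s # u))"
  shows "form_simple s \<beta> = \<beta> s - flow s u \<beta>"
proof -
  have "form_simple s \<beta> = (\<Sum>t\<in>set (s # u). form_entry s t * \<beta> t)"
    unfolding form_simple_def using assms finite_S
      by (intro sum.mono_neutral_right) (auto simp: supported_def)
  then show ?thesis using assms by (simp add: flow_set form_entry_same sum_negf)
qed

lemma simple_refl_at_flow:
  assumes "distinct (s # u)" "set (s # u) \<subseteq> S" "v \<in> supported (set (s # u))"
  shows "simple_refl s v s = 2 * flow s u v - v s"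
  unfolding simple_refl_at form_simple_flow[OF assms] by simp

text \<open>Only the terms with \<open>s\<close> differ. Reflection turns the coordinate at
  \<open>s\<close> into twice the flow minus its old value, so in front and at the end alike these
  terms amount to minus the old coordinate of \<beta> times the new coordinate of \<gamma>. This is
  the numerical shadow of a reflection functor.\<close>

lemma euler_rotate:
  assumes "distinct (s # u)" "set (s # u) \<subseteq> S"
    and "\<beta> \<in> supported (set (s # u))" "\<gamma> \<in> supported (set (s # u))"
  shows "euler (u @ [s]) (simple_refl s \<beta>) (simple_refl s \<gamma>) = euler (s # u) \<beta> \<gamma>"
proof -
  have "euler u (simple_refl s \<beta>) (simple_refl s \<gamma>) = euler u \<beta> \<gamma>"
    using assms by (intro euler_cong simple_refl_other) auto
  moreover have "flow s u (simple_refl s v) = flow s u v" for v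
    using assms by (intro flow_cong simple_refl_other) auto
  ultimately show ?thesis
    using assms(2)
    by (simp add: euler_snoc simple_refl_at_flow[OF assms(1,2,3)] simple_refl_at_flow[OF assms(1,2,4)] algebra_simps)
qed

lemma euler_simple_left:
  assumes "s \<notin> set u"
  shows "euler (s # u) (simple s) \<gamma> = \<gamma> s - 2 * flow s u \<gamma>"
proof -
  have "euler u (simple s) \<gamma> = 0"
    using assms by (intro euler_zero_left) (auto simp: simple_def)
  then show ?thesis by simp
qed

lemma flow_nonneg:
  "s \<notin> set u \<Longrightarrow> set (s # u) \<subseteq> S \<Longrightarrow> (\<And>x. \<beta> x \<ge> 0) \<Longrightarrow> flow s u \<beta> \<ge> 0"
proof (induction u)
  case (Cons r u)
  then have "form_entry s r * \<beta> r \<le> 0" using form_entry_nonpos[of s r]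
    by (simp add: mult_nonpos_nonneg)
  then show ?case using Cons by simp
qed simp

section \<open>Descents and covers in the weak order\<close>

lemma left_descent:
  assumes "J \<subseteq> S" "w \<in> generate G J" "w \<noteq> \<one>"
  shows "\<exists>r\<in>J. simple r \<in> inv_roots w \<and> cox_length G J (r \<otimes> w) < cox_length G J w"
proof -
  obtain u where u: "u \<in> lists J" "word_prod G u = w" "length u = cox_length G J w"
    using reduced_exists[OF assms(1,2)] .
  then obtain r u' where ru: "u = r # u'" using assms(3) by (cases u) auto
  then have r: "r \<in> J" "r \<in> S" and u': "u' \<in> lists J" using u assms(1) by auto
  have w': "word_prod G u' \<in> carrier G" using wp_closed lists_S[OF assms(1) u'] by blast
  have rw: "r \<otimes> w = word_prod G u'" using u(2) ru S_cancel[OF r(2) w'] by auto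
  then have less: "cox_length G J (r \<otimes> w) < cox_length G J w"
    using cox_length_le[OF u'] u(3) ru by simp
  have "simple r \<in> inv_roots w"
  proof (rule ccontr)
    assume "simple r \<notin> inv_roots w"
    then have "simple r \<in> inv_roots (word_prod G u')"
      using inv_roots_mult_up[OF r(2) generate_carrier[OF assms(1,2)]] rw by auto
    then have "cox_length G J (r \<otimes> word_prod G u') < cox_length G J (word_prod G u')"
      using deletion(3)[OF assms(1) wp_in_generate[OF assms(1) u'], of "simple r"] r(2)
      by (simp add: root_reflection_simple)
    then show False using less rw u(2) ru by simp
  qed
  then show ?thesis using r less by blast
qed

lemma right_descent:
  assumes "J \<subseteq> S" "g \<in> generate G J" "g \<noteq> \<one>"
  shows "\<exists>j\<in>J. - act g (simple j) \<in> pos_roots"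
proof -
  have "inv g \<in> generate G J" "g \<in> carrier G"
    using assms generate_inv generate_carrier by auto
  moreover from this have "inv g \<noteq> \<one>" using assms(3) by (metis inv_inv inv_one)
  ultimately show ?thesis using left_descent[OF assms(1), of "inv g"] by (auto simp: inv_roots_def)
qed

text \<open>Among the positive roots the last reflection makes only \<open>simple j\<close>
  negative, so exactly one root changes status: this is a cover in the weak order.\<close>

lemma inv_roots_mult_right:
  assumes "w \<in> carrier G" "j \<in> S" "act w (simple j) \<in> pos_roots"
  shows "inv_roots (w \<otimes> j) = insert (act w (simple j)) (inv_roots w)"
proof -
  let ?\<beta> = "act w (simple j)"
  have act: "act (inv (w \<otimes> j)) \<gamma> = simple_refl j (act (inv w) \<gamma>)" for \<gamma>
    using assms S_carrier by (simp add: inv_mult_group S_inv act_mult act_simple)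
  have w\<beta>: "act (inv w) ?\<beta> = simple j" using assms by (simp add: act_inv)
  have "\<gamma> \<in> inv_roots w \<or> \<gamma> = ?\<beta>" if "\<gamma> \<in> inv_roots (w \<otimes> j)" for \<gamma>
  proof (cases "\<gamma> \<in> inv_roots w")
    case False
    then have pos: "act (inv w) \<gamma> \<in> pos_roots"
      using not_inv_roots[OF assms(1)] inv_roots_pos[OF that] by blast
    have "- simple_refl j (act (inv w) \<gamma>) \<in> pos_roots" using that by (simp add: inv_roots_def act)
    then have "act (inv w) \<gamma> = simple j" using simple_refl_pos[OF assms(2) pos] pos_not_neg by blast
    then show ?thesis using w\<beta> assms(1) act_inv' by metis
  qed simp
  moreover have "\<gamma> \<in> inv_roots (w \<otimes> j)" if "\<gamma> \<in> inv_roots w" for \<gamma>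
  proof -
    have "act (inv w) \<gamma> = - simple j \<Longrightarrow> \<gamma> = - ?\<beta>"
      using w\<beta> act_inv'[OF assms(1)] by (metis act_uminus)
    then have "- act (inv w) \<gamma> \<noteq> simple j"
      using inv_roots_pos[OF that] pos_not_neg[OF assms(3)] by (metis uminus_uminus_fun)
    then have "simple_refl j (- act (inv w) \<gamma>) \<in> pos_roots"
      using simple_refl_pos[OF assms(2)] that by (simp add: inv_roots_def)
    then show ?thesis using inv_roots_pos[OF that]
      by (simp add: inv_roots_def act simple_refl_uminus)
  qed
  moreover have "?\<beta> \<in> inv_roots (w \<otimes> j)"
    using assms simple_pos by (simp add: inv_roots_def act w\<beta> simple_refl_simple_self)
  ultimately show ?thesis by blast
qed

text \<open>The assumption means \<open>s \<otimes> w = w \<otimes> j\<close>, which turns a left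
  multiplication into a cover.\<close>

lemma inv_roots_mult_cover:
  assumes "s \<in> S" "w \<in> carrier G" "j \<in> S" "act (inv w) (simple s) = simple j"
  shows "inv_roots (s \<otimes> w) = insert (simple s) (inv_roots w)"
proof -
  have ws: "act w (simple j) = simple s" using assms act_inv' by metis
  then have "w \<otimes> j \<otimes> inv w = s"
    using root_reflection_act[OF assms(2,3)] root_reflection_simple[OF assms(1)] by simp
  then have "s \<otimes> w = w \<otimes> j"
    using assms S_carrier by (metis inv_closed l_inv m_assoc m_closed r_one)
  then show ?thesis using inv_roots_mult_right[OF assms(2,3)] simple_pos[OF assms(1)] ws by simp
qed

text \<open>Choose \<open>x'\<close> with as many inversions as possible among the elements between
  \<open>x\<close> and \<open>y\<close> not above \<open>s\<close>. As \<open>x'\<close> is not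
  \<open>y\<close>, some \<open>x' \<otimes> j\<close> covers it and is still below
  \<open>y\<close>; by maximality its new inversion is \<open>simple s\<close>.\<close>

lemma exists_cover:
  assumes "J \<subseteq> S" "x \<in> generate G J" "y \<in> generate G J" "inv_roots x \<subseteq> inv_roots y"
    and "s \<in> J" "simple s \<in> inv_roots y" "simple s \<notin> inv_roots x"
  obtains x' j where "x' \<in> generate G J" "inv_roots x \<subseteq> inv_roots x'" "simple s \<notin> inv_roots x'"
    "inv_roots x' \<subseteq> inv_roots y"
    "j \<in> S" "act (inv x') (simple s) = simple j"
proof -
  define P where
    "P x' \<longleftrightarrow> x' \<in> generate G J \<and> inv_roots x \<subseteq> inv_roots x' \<and> simple s \<notin> inv_roots x' \<and> inv_roots x' \<subseteq> inv_roots y" for x'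
  have fin: "finite (inv_roots y)" using finite_inv_roots generate_carrier assms by blast
  have "P x" unfolding P_def using assms by blast
  moreover have "\<forall>z. P z \<longrightarrow> card (inv_roots z) \<le> card (inv_roots y)"
    unfolding P_def using fin card_mono by blast
  ultimately obtain x' where x': "P x'" and max:
    "\<And>z. P z \<Longrightarrow> card (inv_roots z) \<le> card (inv_roots x')"
    using ex_has_greatest_nat[of P x "\<lambda>z. card (inv_roots z)" "Suc (card (inv_roots y))"]
      by (metis le_imp_less_Suc less_imp_le)
  have x'J: "x' \<in> generate G J" and sx': "simple s \<notin> inv_roots x'" "inv_roots x' \<subseteq> inv_roots y"
    "inv_roots x \<subseteq> inv_roots x'"
    using x' by (auto simp: P_def)
  have c: "x' \<in> carrier G" "y \<in> carrier G" using x'J assms generate_carrier by auto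
  have "inv y \<otimes> x' \<noteq> \<one>"
    using sx' assms(6) c by (metis inv_closed inv_equality inv_inv)
  then obtain j where j: "j \<in> J" "- act (inv y \<otimes> x') (simple j) \<in> pos_roots"
    using right_descent[OF assms(1) generate_mult[OF generate_inv[OF assms(1,3)] x'J]] by blast
  have jS: "j \<in> S" using j assms by auto
  define \<beta> where "\<beta> = act x' (simple j)"
  have neg: "- act (inv y) \<beta> \<in> pos_roots" using j c by (simp add: \<beta>_def act_mult)
  have \<beta>r: "\<beta> \<in> roots" unfolding \<beta>_def using act_in_roots[OF c(1) simple_in_roots[OF jS]] .
  have x'\<beta>: "act (inv x') \<beta> = simple j" unfolding \<beta>_def using c by (simp add: act_inv)
  have \<beta>: "\<beta> \<in> pos_roots"
  proof (rule ccontr)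
    assume "\<beta> \<notin> pos_roots"
    then have "- \<beta> \<in> pos_roots" using root_cases[OF \<beta>r] by blast
    then have "- \<beta> \<in> inv_roots x'" using x'\<beta> simple_pos[OF jS]
      by (simp add: inv_roots_def act_uminus)
    then have "- \<beta> \<in> inv_roots y" using sx' by blast
    then show False using neg pos_not_neg by (auto simp: inv_roots_def act_uminus)
  qed
  have "\<beta> = simple s"
  proof (rule ccontr)
    assume ne: "\<beta> \<noteq> simple s"
    have eq: "inv_roots (x' \<otimes> j) = insert \<beta> (inv_roots x')"
      using inv_roots_mult_right[OF c(1) jS] \<beta> by (simp add: \<beta>_def)
    have "\<beta> \<in> inv_roots y" using \<beta> neg by (simp add: inv_roots_def)
    then have "P (x' \<otimes> j)"
      unfolding P_def eq using x' ne generate_mult[OF x'J generate_simple[OF j(1)]]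
        by (auto simp: P_def)
    moreover have "\<beta> \<notin> inv_roots x'" using not_inv_roots[OF c(1) \<beta>] x'\<beta> simple_pos[OF jS] by simp
    ultimately show False using max[of "x' \<otimes> j"] finite_inv_roots[OF c(1)] unfolding eq by simp
  qed
  then show ?thesis using that[of x' j] x'J sx' jS x'\<beta> by blast
qed

section \<open>The projection along a Coxeter word\<close>

text \<open>In \<open>run u w p C\<close> the first letter of the Coxeter word \<open>u\<close> is the initial letter that is chosen.
  The set \<open>C\<close> collects the normal roots of the walls of the Cambrian cone, which is the region covered
  by the fibre of \<open>p\<close>.\<close>

inductive run :: "'a list \<Rightarrow> 'a \<Rightarrow> 'a \<Rightarrow> ('a \<Rightarrow> real) set \<Rightarrow> bool" where
  stop: "run [] \<one> \<one> {}"
| up: "simple s \<in> inv_roots w \<Longrightarrow> run (u @ [s]) (s \<otimes> w) p C \<Longrightarrow> run (s # u) w (s \<otimes> p) (simple_refl s ` C)"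
| skip: "simple s \<notin> inv_roots w \<Longrightarrow> v \<in> generate G (set u) \<Longrightarrow> inv_roots v = inv_roots w \<inter> supported (set u) \<Longrightarrow>
    run u v p C \<Longrightarrow> run (s # u) w p (insert (simple s) C)"

section \<open>Existence, uniqueness and image of the recursion\<close>

lemma supported_mono: "J \<subseteq> K \<Longrightarrow> supported J \<subseteq> supported K"
  by (auto simp: supported_def)


lemma simple_supported_iff: "simple s \<in> supported J \<longleftrightarrow> s \<in> J"
  by (auto simp: supported_def simple_def)

lemma simple_refl_supported: "\<beta> \<in> supported J \<Longrightarrow> s \<in> J \<Longrightarrow> simple_refl s \<beta> \<in> supported J"
  unfolding supported_def by (auto, metis simple_refl_other)

lemma generate_empty: "w \<in> generate G {} \<Longrightarrow> w = \<one>"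
  using generate_word[of "{}" w] by auto

lemma generate_down: "s \<in> J \<Longrightarrow> w \<in> generate G J \<Longrightarrow> s \<otimes> w \<in> generate G J"
  by (rule generate_mult[OF generate_simple])

lemma parabolic_exists:
  assumes "K \<subseteq> S" "w \<in> carrier G"
  obtains v where "v \<in> generate G K" "inv_roots v = inv_roots w \<inter> supported K"
  using parabolic_factor[OF assms] by metis

lemma card_inv_roots_down:
  assumes "s \<in> S" "w \<in> carrier G" "simple s \<in> inv_roots w"
  shows "card (inv_roots (s \<otimes> w)) < card (inv_roots w)"
proof -
  have sw: "s \<otimes> w \<in> carrier G" using assms S_carrier by simp
  have inj: "inj_on (simple_refl s) X" for X using simple_refl_simple_refl[OF assms(1)]
    by (metis inj_onI)
  have "simple s \<notin> simple_refl s ` inv_roots (s \<otimes> w)"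
    using simple_refl_ne_simple[OF assms(1)] inv_roots_pos by (metis imageE)
  then show ?thesis
    unfolding inv_roots_mult_down(2)[OF assms] using finite_inv_roots[OF sw]
      by (simp add: card_image[OF inj])
qed

lemma card_inv_roots_mono:
  "w \<in> carrier G \<Longrightarrow> inv_roots v \<subseteq> inv_roots w \<Longrightarrow> card (inv_roots v) \<le> card (inv_roots w)"
  by (simp add: card_mono finite_inv_roots)

lemma simple_refl_mem_inv_roots_down:
  assumes "s \<in> S" "w \<in> carrier G" "simple s \<in> inv_roots w" "\<beta> \<in> inv_roots (s \<otimes> w)"
  shows "simple_refl s \<beta> \<in> inv_roots w"
  using inv_roots_mult_down(2)[OF assms(1-3)] assms(4) by blast

lemma inv_roots_up_mono:
  assumes "s \<in> S" "v \<in> carrier G" "w \<in> carrier G" "simple s \<notin> inv_roots v" "simple s \<notin> inv_roots w"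
    "inv_roots v \<subseteq> inv_roots w"
  shows "inv_roots (s \<otimes> v) \<subseteq> inv_roots (s \<otimes> w)"
  using assms by (auto simp: inv_roots_mult_up)

lemma inv_roots_down_mono:
  assumes "s \<in> S" "v \<in> carrier G" "w \<in> carrier G" "simple s \<in> inv_roots v"
    "inv_roots v \<subseteq> inv_roots w"
  shows "inv_roots (s \<otimes> v) \<subseteq> inv_roots (s \<otimes> w)"
proof
  fix \<beta> assume \<beta>: "\<beta> \<in> inv_roots (s \<otimes> v)"
  have sw: "simple s \<in> inv_roots w" using assms by blast
  have "simple_refl s \<beta> \<in> inv_roots w"
    using simple_refl_mem_inv_roots_down[OF assms(1,2,4) \<beta>] assms(5) by blast
  moreover have "simple_refl s \<beta> \<noteq> simple s"
    using simple_refl_ne_simple[OF assms(1) inv_roots_pos[OF \<beta>]] .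
  ultimately have "simple_refl s \<beta> \<in> simple_refl s ` inv_roots (s \<otimes> w)"
    using inv_roots_mult_down(2)[OF assms(1,3) sw] by blast
  then show "\<beta> \<in> inv_roots (s \<otimes> w)" using simple_refl_simple_refl[OF assms(1)] by (metis imageE)
qed

text \<open>Rotation keeps the length of the word and loses an inversion; skipping loses a letter
  and gains no inversion.\<close>

lemma run_exists:
  "distinct u \<Longrightarrow> set u \<subseteq> S \<Longrightarrow> w \<in> generate G (set u) \<Longrightarrow> \<exists>p C. run u w p C"
proof (induction "length u + card (inv_roots w)" arbitrary: u w rule: less_induct)
  case less
  show ?case
  proof (cases u)
    case Nil
    then have "w = \<one>" using less.prems(3) generate_empty by simp
    then show ?thesis using Nil run.stop by blast
  next
    case (Cons s u')
    have w: "w \<in> carrier G" using less.prems generate_carrier by blast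
    show ?thesis
    proof (cases "simple s \<in> inv_roots w")
      case True
      have "\<exists>p C. run (u' @ [s]) (s \<otimes> w) p C"
      proof (rule less.hyps)
        show "length (u' @ [s]) + card (inv_roots (s \<otimes> w)) < length u + card (inv_roots w)"
          using card_inv_roots_down[OF _ w True] less.prems Cons by simp
        show "s \<otimes> w \<in> generate G (set (u' @ [s]))"
          using generate_down[of s "set u" w] less.prems Cons by simp
      qed (use less.prems Cons in auto)
      then show ?thesis using run.up[OF True] Cons by blast
    next
      case False
      have u': "set u' \<subseteq> S" using less.prems Cons by simp
      obtain v where v: "v \<in> generate G (set u')" "inv_roots v = inv_roots w \<inter> supported (set u')"
        using parabolic_exists[OF u' w] .
      have "\<exists>p C. run u' v p C"
      proof (rule less.hyps)
        have "card (inv_roots v) \<le> card (inv_roots w)" using card_inv_roots_mono[OF w] v(2) by blast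
        then show "length u' + card (inv_roots v) < length u + card (inv_roots w)" using Cons
          by simp
      qed (use less.prems Cons u' v in auto)
      then show ?thesis using run.skip[OF False v] Cons by blast
    qed
  qed
qed

lemma run_deterministic:
  "run u w p C \<Longrightarrow> distinct u \<Longrightarrow> set u \<subseteq> S \<Longrightarrow> run u w p' C' \<Longrightarrow> p' = p \<and> C' = C"
proof (induction arbitrary: p' C' rule: run.induct)
  case stop
  then show ?case by (auto elim: run.cases)
next
  case (up s w u p C)
  from up.prems(3) obtain q D where "p' = s \<otimes> q" "C' = simple_refl s ` D"
    "run (u @ [s]) (s \<otimes> w) q D"
    using up.hyps(1) by (auto elim: run.cases)
  then show ?case using up.IH[of q D] up.prems by auto
next
  case (skip s w v u p C)
  from skip.prems(3) obtain v' D where v': "v' \<in> generate G (set u)"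
    "inv_roots v' = inv_roots w \<inter> supported (set u)"
      "run u v' p' D" "C' = insert (simple s) D"
    using skip.hyps(1) by (auto elim: run.cases)
  have "v' = v"
    using inv_roots_inj[of v' v] v' skip.hyps(2,3) skip.prems generate_carrier[of "set u"] by auto
  then show ?case using skip.IH[of p' D] skip.prems v' by auto
qed

lemma run_image:
  "run u w p C \<Longrightarrow> distinct u \<Longrightarrow> set u \<subseteq> S \<Longrightarrow> w \<in> generate G (set u) \<Longrightarrow>
    p \<in> generate G (set u) \<and> inv_roots p \<subseteq> inv_roots w"
proof (induction rule: run.induct)
  case stop
  then show ?case by (simp add: generate.one)
next
  case (up s w u p C)
  have s: "s \<in> S" "set (u @ [s]) = set (s # u)" using up.prems by auto
  have w: "w \<in> carrier G" using up.prems generate_carrier by blast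
  have "s \<otimes> w \<in> generate G (set (u @ [s]))"
    using generate_down[of s "set (s # u)" w] up.prems s(2) by simp
  then have p: "p \<in> generate G (set (s # u))" "inv_roots p \<subseteq> inv_roots (s \<otimes> w)"
    using up.IH up.prems s(2) by auto
  have pc: "p \<in> carrier G" using p generate_carrier up.prems by blast
  have "simple s \<notin> inv_roots (s \<otimes> w)" using inv_roots_mult_down(1)[OF s(1) w up.hyps(1)] .
  then have "inv_roots (s \<otimes> p) \<subseteq> inv_roots (s \<otimes> (s \<otimes> w))"
    using inv_roots_up_mono[OF s(1) pc, of "s \<otimes> w"] p w S_carrier[OF s(1)] by auto
  then show ?case using generate_down[of s "set (s # u)" p] p(1) S_cancel[OF s(1) w] by simp
next
  case (skip s w v u p C)
  then show ?case using generate_mono[of "set u" "set (s # u)" p] by auto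
qed

section \<open>The walls of the Cambrian cone\<close>

text \<open>Positivity expresses that the region of \<open>w\<close> lies inside the cone. When a
  letter is skipped, the older walls are supported on the remaining letters, and on such roots
  \<open>w\<close> and \<open>v\<close> have the same signs.\<close>

lemma run_cone_roots:
  "run u w p C \<Longrightarrow> distinct u \<Longrightarrow> set u \<subseteq> S \<Longrightarrow> w \<in> generate G (set u) \<Longrightarrow>
    finite C \<and> C \<subseteq> roots \<inter> supported (set u) \<and> (\<forall>\<xi>\<in>C. act (inv w) \<xi> \<in> pos_roots)"
proof (induction rule: run.induct)
  case (up s w u p C)
  have s: "s \<in> S" "set (u @ [s]) = set (s # u)" using up.prems by auto
  have w: "w \<in> carrier G" using up.prems generate_carrier by blast
  have "s \<otimes> w \<in> generate G (set (u @ [s]))"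
    using generate_down[of s "set (s # u)" w] up.prems s(2) by simp
  then have IH: "finite C" "C \<subseteq> roots \<inter> supported (set (s # u))"
    "\<forall>\<xi>\<in>C. act (inv (s \<otimes> w)) \<xi> \<in> pos_roots"
    using up.IH up.prems s(2) by auto
  have "act (inv (s \<otimes> w)) \<xi> = act (inv w) (simple_refl s \<xi>)" for \<xi>
    using s w S_carrier by (simp add: inv_mult_group S_inv act_mult act_simple)
  then show ?case
    using IH simple_refl_in_roots[OF s(1)] simple_refl_supported[of _ "set (s # u)" s] by auto
next
  case (skip s w v u p C)
  have s: "s \<in> S" "set u \<subseteq> S" using skip.prems by auto
  have w: "w \<in> carrier G" "v \<in> carrier G"
    using generate_carrier[OF skip.prems(2,3)] generate_carrier[OF s(2) skip.hyps(2)] by auto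
  have IH: "finite C" "C \<subseteq> roots \<inter> supported (set u)" "\<forall>\<xi>\<in>C. act (inv v) \<xi> \<in> pos_roots"
    using skip.IH skip.prems skip.hyps s by auto
  have "act (inv w) (simple s) \<in> pos_roots"
    using not_inv_roots[OF w(1) simple_pos[OF s(1)]] skip.hyps by blast
  moreover have "act (inv w) \<xi> \<in> pos_roots" if "\<xi> \<in> C" for \<xi>
  proof -
    have \<xi>: "\<xi> \<in> roots" "\<xi> \<in> supported (set u)" "act (inv v) \<xi> \<in> pos_roots" using IH that by auto
    consider "\<xi> \<in> pos_roots" | "- \<xi> \<in> pos_roots" using root_cases \<xi> by blast
    then show ?thesis
    proof cases
      case 1
      then have "\<xi> \<notin> inv_roots v" using not_inv_roots[OF w(2)] \<xi> by blast
      then have "\<xi> \<notin> inv_roots w" using skip.hyps(3) \<xi> by blast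
      then show ?thesis using not_inv_roots[OF w(1) 1] by blast
    next
      case 2
      then have "- \<xi> \<in> inv_roots v" using \<xi> by (simp add: inv_roots_def act_uminus)
      then have "- \<xi> \<in> inv_roots w" using skip.hyps(3) by blast
      then show ?thesis by (simp add: inv_roots_def act_uminus)
    qed
  qed
  moreover have "supported (set u) \<subseteq> supported (set (s # u))" by (rule supported_mono) auto
  ultimately show ?case
    using IH simple_in_roots[OF s(1)] by (auto simp: simple_supported_iff)
qed simp

text \<open>In dual form, \<open>\<mu>\<close> lies in the cone spanned by \<open>C\<close>. In terms of quiver representations the
  condition on \<open>\<mu>\<close> says that there are no maps from the torsion class of \<open>w\<close> to \<open>\<mu>\<close>.\<close>

lemma run_cone_nonneg:
  "run u w p C \<Longrightarrow> distinct u \<Longrightarrow> set u \<subseteq> S \<Longrightarrow> w \<in> generate G (set u) \<Longrightarrow>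
    (\<And>x. \<mu> x \<ge> 0) \<Longrightarrow> \<mu> \<in> supported (set u) \<Longrightarrow> (\<And>\<eta>. \<eta> \<in> inv_roots w \<Longrightarrow> euler u \<eta> \<mu> \<le> 0) \<Longrightarrow>
    (\<And>a v b v'. f (lincomb a v b v') = a * f v + b * f v') \<Longrightarrow> (\<And>\<xi>. \<xi> \<in> C \<Longrightarrow> f \<xi> \<ge> (0 :: real)) \<Longrightarrow> f \<mu> \<ge> 0"
proof (induction arbitrary: \<mu> f rule: run.induct)
  case stop
  then have "\<mu> = lincomb 0 \<mu> 0 \<mu>" by (auto simp: supported_def lincomb_def)
  then have "f \<mu> = 0" using stop.prems(7)[of 0 \<mu> 0 \<mu>] by simp
  then show ?case by simp
next
  case (up s w u p C)
  note su = up.prems(1,2)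
  have s: "s \<in> S" "s \<notin> set u" "set (u @ [s]) = set (s # u)" using su by auto
  have w: "w \<in> carrier G" using up.prems(3) su generate_carrier by blast
  have sw: "s \<otimes> w \<in> generate G (set (u @ [s]))"
    using generate_down[of s "set (s # u)" w] up.prems(3) s(3) by simp
  have \<mu>: "\<mu> \<in> supported (set (s # u))" using up.prems(5) .
  have "f (simple_refl s (simple_refl s \<mu>)) \<ge> 0"
  proof (rule up.IH[OF _ _ sw, where f = "\<lambda>v. f (simple_refl s v)"])
    \<comment> \<open>The hypothesis for the inversion \<open>simple s\<close> is exactly what keeps
      the coordinate at \<open>s\<close> nonnegative after the reflection.\<close>
    have "\<mu> s - 2 * flow s u \<mu> \<le> 0"
      using up.prems(6)[OF up.hyps(1)] euler_simple_left[OF s(2)] by simp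
    then show "simple_refl s \<mu> x \<ge> 0" for x
      using simple_refl_at_flow[OF su \<mu>] flow_nonneg[OF s(2) su(2) up.prems(4)] up.prems(4)[of x]
      by (cases "x = s") (auto simp: simple_refl_other)
  next
    show "simple_refl s \<mu> \<in> supported (set (u @ [s]))" using simple_refl_supported[OF \<mu>] s(3)
      by simp
  next
    fix \<eta> assume \<eta>: "\<eta> \<in> inv_roots (s \<otimes> w)"
    have "\<eta> \<in> supported (set (s # u))"
      using inv_roots_supported[OF _ sw] \<eta> su s(3) by auto
    then have "simple_refl s \<eta> \<in> supported (set (s # u))" by (intro simple_refl_supported) auto
    then have "euler (u @ [s]) (simple_refl s (simple_refl s \<eta>)) (simple_refl s \<mu>) = euler (s # u) (simple_refl s \<eta>) \<mu>"
      using euler_rotate[OF su _ \<mu>] by blast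
    also have "\<dots> \<le> 0" using up.prems(6) simple_refl_mem_inv_roots_down[OF s(1) w up.hyps(1) \<eta>]
      by blast
    finally show "euler (u @ [s]) \<eta> (simple_refl s \<mu>) \<le> 0" using simple_refl_simple_refl[OF s(1)]
      by simp
  next
    show "distinct (u @ [s])" "set (u @ [s]) \<subseteq> S" using su by auto
  next
    show "f (simple_refl s \<xi>) \<ge> 0" if "\<xi> \<in> C" for \<xi> using up.prems(8) that by blast
  qed (simp add: simple_refl_lincomb up.prems(7))
  then show ?case using simple_refl_simple_refl[OF s(1)] by simp
next
  case (skip s w v u p C)
  \<comment> \<open>The coordinate at \<open>s\<close> is accounted for by the new wall
    \<open>simple s\<close>. The inversions of \<open>v\<close> vanish at \<open>s\<close>, so their
    Euler form with \<mu> is unaffected by erasing it.\<close>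
  define \<mu>' where "\<mu>' = \<mu>(s := 0)"
  have "f \<mu>' \<ge> 0"
  proof (rule skip.IH[where f = f and \<mu> = \<mu>'])
    show "\<mu>' \<in> supported (set u)" using skip.prems(5) by (auto simp: \<mu>'_def supported_def)
    fix \<eta> assume \<eta>: "\<eta> \<in> inv_roots v"
    then have \<eta>w: "\<eta> \<in> inv_roots w" "\<eta> \<in> supported (set u)" using skip.hyps(3) by auto
    then have "\<eta> s = 0" using skip.prems(1) by (auto simp: supported_def)
    then have "euler (s # u) \<eta> \<mu> = euler u \<eta> \<mu>" by simp
    also have "\<dots> = euler u \<eta> \<mu>'"
      using skip.prems(1) by (intro euler_cong) (auto simp: \<mu>'_def)
    finally show "euler u \<eta> \<mu>' \<le> 0" using skip.prems(6)[OF \<eta>w(1)] by simp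
  qed (use skip.prems skip.hyps in \<open>auto simp: \<mu>'_def\<close>)
  moreover have "\<mu> = lincomb 1 \<mu>' (\<mu> s) (simple s)"
    by (auto simp: \<mu>'_def lincomb_def simple_def fun_eq_iff)
  then have "f \<mu> = f \<mu>' + \<mu> s * f (simple s)" using skip.prems(7) by (metis mult_1)
  ultimately show ?case using skip.prems(4)[of s] skip.prems(8)[of "simple s"] by simp
qed

text \<open>Peel off a left descent \<open>r\<close>. Its simple root is an inversion, hence
  orthogonal to \<open>simple s\<close>, so reflecting in it preserves the orthogonality of the
  remaining inversions.\<close>

lemma fixes_simple:
  assumes "K \<subseteq> S" "s \<in> S" "p \<in> generate G K" "\<And>\<eta>. \<eta> \<in> inv_roots p \<Longrightarrow> form_simple s \<eta> = 0"
  shows "act p (simple s) = simple s"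
  using assms(3,4)
proof (induction "cox_length G K p" arbitrary: p rule: less_induct)
  case less
  show ?case
  proof (cases "p = \<one>")
    case True
    then show ?thesis by (simp add: act_one)
  next
    case False
    then obtain r where r: "r \<in> K" "simple r \<in> inv_roots p"
      "cox_length G K (r \<otimes> p) < cox_length G K p"
      using left_descent[OF assms(1) less.prems(1)] by blast
    have rS: "r \<in> S" "r \<in> carrier G" using r assms S_carrier by auto
    have p: "p \<in> carrier G" using less.prems generate_carrier[OF assms(1)] by blast
    have "form_entry s r = 0" using less.prems(2)[OF r(2)] rS by (simp add: form_simple_simple)
    then have rs: "simple_refl r (simple s) = simple s"
      using assms(2) rS form_entry_sym by (simp add: simple_refl_def lincomb_def form_simple_simple)
    have "act (r \<otimes> p) (simple s) = simple s"
    proof (rule less.hyps[OF r(3) generate_down[OF r(1) less.prems(1)]])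
      fix \<eta> assume "\<eta> \<in> inv_roots (r \<otimes> p)"
      then have "form_simple s (simple_refl r \<eta>) = 0"
        using less.prems(2) simple_refl_mem_inv_roots_down[OF rS(1) p r(2)] by blast
      moreover have "form (simple_refl r (simple s)) (simple_refl r \<eta>) = form (simple s) \<eta>"
        by (rule form_simple_refl[OF rS(1)])
      ultimately show "form_simple s \<eta> = 0" using assms(2) by (simp add: rs form_simple_left)
    qed
    then have "simple_refl r (act p (simple s)) = simple s" using rS p
      by (simp add: act_mult act_simple)
    then show ?thesis using rs simple_refl_simple_refl[OF rS(1)] by metis
  qed
qed

text \<open>The Euler condition rotates along with the word, so it suffices to look where a wall is
  created. There it says that the flow into \<open>s\<close> of each inversion of \<open>p\<close>
  is at most 0. It is also at least 0, so all inversions are orthogonal to \<open>simple s\<close>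
  and \<open>p\<close> fixes that root.\<close>

lemma run_wall_simple:
  "run u w p C \<Longrightarrow> distinct u \<Longrightarrow> set u \<subseteq> S \<Longrightarrow> w \<in> generate G (set u) \<Longrightarrow>
    \<xi> \<in> C \<Longrightarrow> (\<And>\<eta>. \<eta> \<in> inv_roots p \<Longrightarrow> euler u \<xi> \<eta> \<ge> 0) \<Longrightarrow> \<exists>j\<in>S. act (inv p) \<xi> = simple j"
proof (induction arbitrary: \<xi> rule: run.induct)
  case (up s w u p C)
  note su = up.prems(1,2)
  have s: "s \<in> S" "set (u @ [s]) = set (s # u)" using su by auto
  have w: "w \<in> carrier G" using up.prems(3) su generate_carrier by blast
  have sw: "s \<otimes> w \<in> generate G (set (u @ [s]))"
    using generate_down[of s "set (s # u)" w] up.prems(3) s(2) by simp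
  have u's: "distinct (u @ [s])" "set (u @ [s]) \<subseteq> S" using su by auto
  have p: "p \<in> generate G (set (u @ [s]))" "inv_roots p \<subseteq> inv_roots (s \<otimes> w)"
    using run_image[OF up.hyps(2) u's sw] by auto
  have pc: "p \<in> carrier G" using p u's generate_carrier by blast
  have "simple s \<notin> inv_roots p" using p inv_roots_mult_down(1)[OF s(1) w up.hyps(1)] by blast
  note inv_roots = inv_roots_mult_up[OF s(1) pc this]
  obtain \<zeta> where \<zeta>: "\<zeta> \<in> C" "\<xi> = simple_refl s \<zeta>" using up.prems(4) by blast
  have "\<zeta> \<in> supported (set (u @ [s]))" using run_cone_roots[OF up.hyps(2) u's sw] \<zeta> by blast
  then have \<xi>: "\<xi> \<in> supported (set (s # u))" using \<zeta>(2) s(2) simple_refl_supported by simp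
  have "\<exists>j\<in>S. act (inv p) \<zeta> = simple j"
  proof (rule up.IH[OF u's sw \<zeta>(1)])
    fix \<eta> assume \<eta>: "\<eta> \<in> inv_roots p"
    have "\<eta> \<in> supported (set (u @ [s]))" using inv_roots_supported[OF u's(2) p(1)] \<eta> by blast
    then have "simple_refl s \<eta> \<in> supported (set (s # u))" using simple_refl_supported s(2) by simp
    then have "euler (u @ [s]) (simple_refl s \<xi>) (simple_refl s (simple_refl s \<eta>)) = euler (s # u) \<xi> (simple_refl s \<eta>)"
      by (rule euler_rotate[OF su \<xi>])
    then show "euler (u @ [s]) \<zeta> \<eta> \<ge> 0"
      using up.prems(5)[of "simple_refl s \<eta>"] inv_roots \<eta> \<zeta>(2) simple_refl_simple_refl[OF s(1)]
        by simp
  qed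
  moreover have "act (inv (s \<otimes> p)) \<xi> = act (inv p) \<zeta>"
    using s pc S_carrier \<zeta>(2) simple_refl_simple_refl
      by (simp add: inv_mult_group S_inv act_mult act_simple)
  ultimately show ?case by simp
next
  case (skip s w v u p C)
  have s: "s \<in> S" "s \<notin> set u" "set u \<subseteq> S" "distinct u" using skip.prems by auto
  have p: "p \<in> generate G (set u)" using run_image[OF skip.hyps(4) s(4,3) skip.hyps(2)] by blast
  have pc: "p \<in> carrier G" using p s generate_carrier by blast
  have inv_roots: "\<eta> \<in> supported (set u)" "\<eta> s = 0" if "\<eta> \<in> inv_roots p" for \<eta>
    using inv_roots_supported[OF s(3) p] that s(2) by (auto simp: supported_def)
  show ?case
  proof (cases "\<xi> = simple s")
    case True
    have "form_simple s \<eta> = 0" if \<eta>: "\<eta> \<in> inv_roots p" for \<eta>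
    proof -
      have "flow s u \<eta> \<le> 0"
        using skip.prems(5)[OF \<eta>] inv_roots[OF \<eta>] unfolding True euler_simple_left[OF s(2)] by simp
      moreover have "flow s u \<eta> \<ge> 0"
        using flow_nonneg[OF s(2) skip.prems(2) pos_roots_nonneg[OF inv_roots_pos[OF \<eta>]]] .
      moreover have "\<eta> \<in> supported (set (s # u))"
        using supported_mono[of "set u" "set (s # u)"] inv_roots(1)[OF \<eta>] by auto
      ultimately show ?thesis
        using form_simple_flow[OF skip.prems(1,2)] inv_roots(2)[OF \<eta>] by simp
    qed
    then have "act p (simple s) = simple s" by (rule fixes_simple[OF s(3,1) p])
    then have "act (inv p) \<xi> = simple s" unfolding True using act_inv[OF pc] by metis
    then show ?thesis using s by blast
  next
    case False
    then have \<xi>: "\<xi> \<in> C" using skip.prems by blast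
    have "\<xi> s = 0"
      using run_cone_roots[OF skip.hyps(4) s(4,3) skip.hyps(2)] \<xi> s(2) by (auto simp: supported_def)
    then show ?thesis using skip.IH[OF s(4,3) skip.hyps(2) \<xi>] skip.prems(5) by simp
  qed
qed simp

section \<open>Fixed elements and additional letters\<close>

lemma run_idem:
  "run u w p C \<Longrightarrow> distinct u \<Longrightarrow> set u \<subseteq> S \<Longrightarrow> w \<in> generate G (set u) \<Longrightarrow> \<exists>D. run u p p D"
proof (induction rule: run.induct)
  case stop
  show ?case using run.stop by blast
next
  case (up s w u p C)
  have s: "s \<in> S" "set (u @ [s]) = set (s # u)" using up.prems by auto
  have w: "w \<in> carrier G" using up.prems generate_carrier by blast
  have sw: "s \<otimes> w \<in> generate G (set (u @ [s]))"
    using generate_down[of s "set (s # u)" w] up.prems s(2) by simp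
  have u's: "distinct (u @ [s])" "set (u @ [s]) \<subseteq> S" using up.prems by auto
  have p: "p \<in> generate G (set (u @ [s]))" "inv_roots p \<subseteq> inv_roots (s \<otimes> w)"
    using run_image[OF up.hyps(2) u's sw] by auto
  have pc: "p \<in> carrier G" using p u's generate_carrier by blast
  have "simple s \<notin> inv_roots p" using p inv_roots_mult_down(1)[OF s(1) w up.hyps(1)] by blast
  then have "simple s \<in> inv_roots (s \<otimes> p)" using inv_roots_mult_up[OF s(1) pc] by blast
  moreover obtain D where "run (u @ [s]) p p D" using up.IH[OF u's sw] by blast
  then have "run (u @ [s]) (s \<otimes> (s \<otimes> p)) p D" using S_cancel[OF s(1) pc] by simp
  ultimately show ?case using run.up by blast
next
  case (skip s w v u p C)
  have s: "s \<notin> set u" "set u \<subseteq> S" "distinct u" using skip.prems by auto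
  have p: "p \<in> generate G (set u)" using run_image[OF skip.hyps(4) s(3,2) skip.hyps(2)] by blast
  have "inv_roots p \<subseteq> supported (set u)" using inv_roots_supported[OF s(2) p] .
  then have "simple s \<notin> inv_roots p" "inv_roots p = inv_roots p \<inter> supported (set u)"
    using s(1) simple_supported_iff by auto
  then show ?case using run.skip[OF _ p] skip.IH[OF s(3,2) skip.hyps(2)] by blast
qed

text \<open>An element of the subgroup without \<open>s\<close> is never above \<open>s\<close>, so
  the extra letter is skipped once it comes to the front. Its position is left arbitrary because
  rotations move it forward.\<close>

lemma run_insert:
  "run u w p C \<Longrightarrow> u = a @ c \<Longrightarrow> set u \<subseteq> S \<Longrightarrow> s \<notin> set u \<Longrightarrow> w \<in> generate G (set u) \<Longrightarrow>
    \<exists>D. run (a @ s # c) w p D"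
proof (induction arbitrary: a c rule: run.induct)
  case stop
  have "run [s] \<one> \<one> (insert (simple s) {})"
    using run.skip[OF _ _ _ run.stop, of s \<one>] by (simp add: inv_roots_one generate.one)
  then show ?case using stop by auto
next
  case (up r w u p C)
  show ?case
  proof (cases a)
    case Nil
    have "inv_roots w \<subseteq> supported (set (r # u))" using inv_roots_supported[OF up.prems(2,4)] .
    then have "simple s \<notin> inv_roots w" "inv_roots w = inv_roots w \<inter> supported (set (r # u))"
      using up.prems(3) simple_supported_iff by auto
    then show ?thesis
      using run.skip[OF _ up.prems(4) _ run.up[OF up.hyps]] Nil up.prems(1) by auto
  next
    case (Cons r' a')
    then have ac: "r' = r" "u @ [r] = a' @ c @ [r]" using up.prems(1) by auto
    have "set (u @ [r]) = set (r # u)" by simp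
    then have "r \<otimes> w \<in> generate G (set (u @ [r]))"
      using generate_down[OF _ up.prems(4), of r] by (metis list.set_intros(1))
    moreover have "set (u @ [r]) \<subseteq> S" "s \<notin> set (u @ [r])" using up.prems(2,3) by auto
    ultimately obtain D where "run ((a' @ s # c) @ [r]) (r \<otimes> w) p D"
      using up.IH[OF ac(2)] by auto
    from run.up[OF up.hyps(1) this] show ?thesis using Cons ac(1) by auto
  qed
next
  case (skip r w v u p C)
  show ?case
  proof (cases a)
    case Nil
    have "inv_roots w \<subseteq> supported (set (r # u))" using inv_roots_supported[OF skip.prems(2,4)] .
    then have "simple s \<notin> inv_roots w" "inv_roots w = inv_roots w \<inter> supported (set (r # u))"
      using skip.prems(3) simple_supported_iff by auto
    then show ?thesis
      using run.skip[OF _ skip.prems(4) _ run.skip[OF skip.hyps]] Nil skip.prems(1) by auto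
  next
    case (Cons r' a')
    then have ac: "r' = r" "u = a' @ c" using skip.prems(1) by auto
    obtain D where D: "run (a' @ s # c) v p D"
    proof -
      have "set u \<subseteq> S" "s \<notin> set u" using skip.prems(2,3) by auto
      then show ?thesis using skip.IH[OF ac(2) _ _ skip.hyps(2)] that by blast
    qed
    have "inv_roots w \<subseteq> supported (set (r # u))" using inv_roots_supported[OF skip.prems(2,4)] .
    then have "inv_roots w \<inter> supported (set (a' @ s # c)) \<subseteq> supported (set u)"
      using skip.prems(3) ac(2) by (fastforce simp: supported_def)
    then have "inv_roots v = inv_roots w \<inter> supported (set (a' @ s # c))"
      using skip.hyps(3) supported_mono[of "set u" "set (a' @ s # c)"] ac(2) by auto
    moreover have "v \<in> generate G (set (a' @ s # c))"
      by (rule generate_mono[OF _ skip.hyps(2)]) (use ac(2) in auto)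
    ultimately show ?thesis using run.skip[OF skip.hyps(1) _ _ D] Cons ac(1) by auto
  qed
qed

section \<open>Monotonicity\<close>

text \<open>This is the only case of monotonicity that does not reduce to a smaller one. Some functional
  separates \<open>simple s\<close> from all the other roots in \<open>C\<close>, so \<open>run_cone_nonneg\<close> forces \<open>simple s\<close>
  itself to be in \<open>C\<close>.\<close>

lemma run_cover:
  assumes u: "distinct (s # u)" "set (s # u) \<subseteq> S" and w: "w \<in> generate G (set (s # u))"
    and run: "run (u @ [s]) w p C" and ws: "j \<in> S" "act (inv w) (simple s) = simple j"
  shows "inv_roots p \<subseteq> inv_roots (s \<otimes> p)"
proof -
  have s: "s \<in> S" "s \<notin> set u" "set (u @ [s]) = set (s # u)" using u by auto
  have u's: "distinct (u @ [s])" "set (u @ [s]) \<subseteq> S" using u by auto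
  have wu: "w \<in> generate G (set (u @ [s]))" using w s(3) by simp
  have wc: "w \<in> carrier G" using generate_carrier[OF u(2) w] .
  have p: "p \<in> generate G (set (u @ [s]))" "inv_roots p \<subseteq> inv_roots w"
    using run_image[OF run u's wu] by auto
  have pc: "p \<in> carrier G" using generate_carrier[OF u's(2) p(1)] .
  note C = run_cone_roots[OF run u's wu]
  have "simple s \<in> C"
  proof (rule ccontr)
    assume sC: "simple s \<notin> C"
    \<comment> \<open>In the basis of the images of the simple roots under \<open>w\<close>,
      \<open>h\<close> is the coordinate at \<open>j\<close> and \<open>g\<close> the sum of the
      others. Thus \<open>simple s\<close> has \<open>h = 1\<close> and \<open>g = 0\<close>,
      whereas \<open>g\<close> is positive on every other positive root carried along by
      \<open>w\<close>.\<close>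
    define h where "h v = act (inv w) v j" for v
    define g where "g v = (\<Sum>i\<in>S - {j}. act (inv w) v i)" for v
    have lin: "h (lincomb a v b v') = a * h v + b * h v'"
      "g (lincomb a v b v') = a * g v + b * g v'" for a v b v'
      unfolding h_def g_def act_lincomb by (simp_all add: lincomb_def sum.distrib sum_distrib_left)
    have gpos: "g \<xi> > 0" if "\<xi> \<in> C" for \<xi>
    proof -
      have \<xi>: "act (inv w) \<xi> \<in> pos_roots" using C that by blast
      have "act (inv w) \<xi> \<noteq> simple j"
        using ws sC that wc by (metis act_inv')
      then obtain i where i: "i \<noteq> j" "act (inv w) \<xi> i > 0"
        using pos_root_other_coord[OF ws(1) \<xi>] by blast
      then have "i \<in> S - {j}" using root_support[OF pos_roots_roots[OF \<xi>], of i] by force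
      then show ?thesis unfolding g_def
        using sum_pos2[of "S - {j}" i "act (inv w) \<xi>"] finite_S i pos_roots_nonneg[OF \<xi>] by simp
    qed
    \<comment> \<open>The steepest ratio on \<open>C\<close>, so that \<open>T * g - h\<close> is
      nonnegative on \<open>C\<close> although it is -1 at \<open>simple s\<close>. Inserting 0
      keeps \<open>Max\<close> meaningful for an empty set.\<close>
    define T where "T = Max (insert 0 ((\<lambda>\<xi>. h \<xi> / g \<xi>) ` C))"
    have T: "T * g \<xi> - h \<xi> \<ge> 0" if "\<xi> \<in> C" for \<xi>
    proof -
      have "h \<xi> / g \<xi> \<le> T" unfolding T_def using C that by (intro Max_ge) auto
      then show ?thesis using gpos[OF that] by (simp add: divide_le_eq)
    qed
    have "T * g (simple s) - h (simple s) \<ge> 0"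
    proof (rule run_cone_nonneg[OF run u's wu, where f = "\<lambda>v. T * g v - h v"])
      show "simple s \<in> supported (set (u @ [s]))" by (simp add: simple_supported_iff)
    next
      fix \<eta> assume \<eta>: "\<eta> \<in> inv_roots w"
      have \<eta>p: "\<eta> \<in> pos_roots" using inv_roots_pos[OF \<eta>] .
      have \<eta>s: "\<eta> \<in> supported (set (s # u))" using inv_roots_supported[OF u(2) w] \<eta> by blast
      \<comment> \<open>Being different from \<open>simple s\<close>, the inversion stays positive
        under \<open>simple_refl s\<close>. Since \<open>s\<close> is the last letter, its Euler
        form with \<open>simple s\<close> is minus the resulting coordinate at
        \<open>s\<close>.\<close>
      have "\<eta> \<noteq> simple s"
        using \<eta> ws pos_not_neg[OF simple_pos[OF ws(1)]] by (auto simp: inv_roots_def)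
      then have "simple_refl s \<eta> s \<ge> 0" using pos_roots_nonneg[OF simple_refl_pos[OF s(1) \<eta>p]]
        by blast
      then have "\<eta> s - 2 * flow s u \<eta> \<le> 0" using simple_refl_at_flow[OF u \<eta>s] by simp
      moreover have "euler u \<eta> (simple s) = 0"
        using s(2) by (intro euler_zero_right) (auto simp: simple_def)
      ultimately show "euler (u @ [s]) \<eta> (simple s) \<le> 0"
        using euler_snoc[of u s \<eta> "simple s"] u(2) by simp
    next
      show "T * g (lincomb a v b v') - h (lincomb a v b v') = a * (T * g v - h v) + b * (T * g v' - h v')"
        for a v b v' unfolding lin by (simp add: algebra_simps)
    next
      show "0 \<le> simple s x" for x by (simp add: simple_def)
    qed (rule T)
    moreover have "g (simple s) = 0" "h (simple s) = 1"
      unfolding g_def h_def ws(2) by (auto simp: simple_def)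
    ultimately show False by simp
  qed
  then have "\<exists>i\<in>S. act (inv p) (simple s) = simple i"
  proof (rule run_wall_simple[OF run u's wu])
    fix \<eta> assume \<eta>: "\<eta> \<in> inv_roots p"
    \<comment> \<open>No letter follows \<open>s\<close>, so only the diagonal term
      \<open>\<eta> s\<close> remains.\<close>
    have "euler u (simple s) \<eta> = 0" using s(2) by (intro euler_zero_left) (auto simp: simple_def)
    moreover have "flow s u (simple s) = 0"
      using s(2) by (intro flow_zero) (auto simp: simple_def)
    ultimately show "euler (u @ [s]) (simple s) \<eta> \<ge> 0"
      using euler_snoc[of u s "simple s" \<eta>] u(2) pos_roots_nonneg[OF inv_roots_pos[OF \<eta>]] by simp
  qed
  then obtain i where "i \<in> S" "act (inv p) (simple s) = simple i" by blast
  then show ?thesis using inv_roots_mult_cover[OF s(1) pc] by blast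
qed

lemma run_mono:
  assumes "distinct u" "set u \<subseteq> S" "x \<in> generate G (set u)" "y \<in> generate G (set u)"
    "inv_roots x \<subseteq> inv_roots y"
    and "run u x p C" "run u y q D"
  shows "inv_roots p \<subseteq> inv_roots q"
  using assms
proof (induction "length u + card (inv_roots y)" arbitrary: u x y p C q D rule: less_induct)
  case less
  have xc: "x \<in> carrier G" and yc: "y \<in> carrier G" using less.prems generate_carrier by auto
  show ?case
  proof (cases u)
    case Nil
    then have "p = \<one>" using less.prems(6) by (auto elim: run.cases)
    then show ?thesis by (simp add: inv_roots_one)
  next
    case (Cons s u')
    have su: "distinct (s # u')" "set (s # u') \<subseteq> S" using less.prems Cons by auto
    have s: "s \<in> S" "distinct u'" "set u' \<subseteq> S" "s \<notin> set u'" using su by auto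
    have u's: "distinct (u' @ [s])" "set (u' @ [s]) \<subseteq> S" "set (u' @ [s]) = set (s # u')"
      "length (u' @ [s]) = length u" using su Cons by auto
    have gen: "s \<otimes> w \<in> generate G (set (u' @ [s]))" if "w \<in> generate G (set (s # u'))" for w
      using generate_down[OF _ that, of s] u's(3) by simp
    \<comment> \<open>Stated for any pair below \<open>y\<close>, as it is needed again for
      \<open>x\<close> and the intermediate \<open>x'\<close>; likewise the next claim for
      \<open>s \<otimes> x'\<close> and \<open>y\<close>.\<close>
    have skip_mono: "inv_roots p' \<subseteq> inv_roots q'"
      if w: "w \<in> generate G (set u)" "w' \<in> generate G (set u)" "inv_roots w \<subseteq> inv_roots w'"
        "inv_roots w' \<subseteq> inv_roots y"
        and ns: "simple s \<notin> inv_roots w'" and runs: "run u w p' C'"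
          "run u w' q' D'" for w w' p' q' C' D'
    proof -
      have ns': "simple s \<notin> inv_roots w" using ns w by blast
      obtain v E where v: "v \<in> generate G (set u')"
        "inv_roots v = inv_roots w \<inter> supported (set u')" "run u' v p' E"
        using runs(1) ns' unfolding Cons by (auto elim: run.cases)
      obtain v' E' where v': "v' \<in> generate G (set u')"
        "inv_roots v' = inv_roots w' \<inter> supported (set u')" "run u' v' q' E'"
        using runs(2) ns unfolding Cons by (auto elim: run.cases)
      have "card (inv_roots v') \<le> card (inv_roots y)" using card_inv_roots_mono[OF yc] v'(2) w(4)
        by blast
      then have "length u' + card (inv_roots v') < length u + card (inv_roots y)" using Cons by simp
      then show ?thesis
        using less.hyps[OF _ s(2,3) v(1) v'(1) _ v(3) v'(3)] v(2) v'(2) w(3) by blast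
    qed
    have up_mono: "inv_roots (s \<otimes> p') \<subseteq> inv_roots (s \<otimes> q')"
      if w: "w \<in> generate G (set u)" "w' \<in> generate G (set u)" "inv_roots w \<subseteq> inv_roots w'"
        "inv_roots w' \<subseteq> inv_roots y"
        and ns: "simple s \<in> inv_roots w" and runs: "run (u' @ [s]) (s \<otimes> w) p' C'"
          "run (u' @ [s]) (s \<otimes> w') q' D'"
      for w w' p' q' C' D'
    proof -
      have ns': "simple s \<in> inv_roots w'" using ns w by blast
      have wc: "w \<in> carrier G" "w' \<in> carrier G" using w less.prems(2) generate_carrier by auto
      have sw: "s \<otimes> w \<in> generate G (set (u' @ [s]))" "s \<otimes> w' \<in> generate G (set (u' @ [s]))"
        using gen w Cons by auto
      have "card (inv_roots (s \<otimes> w')) < card (inv_roots w')"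
        using card_inv_roots_down[OF s(1) wc(2) ns'] .
      also have "\<dots> \<le> card (inv_roots y)" using card_inv_roots_mono[OF yc w(4)] .
      finally have "inv_roots p' \<subseteq> inv_roots q'"
        using less.hyps[OF _ u's(1,2) sw inv_roots_down_mono[OF s(1) wc ns w(3)] runs] u's(4)
          by simp
      moreover have "p' \<in> carrier G" "inv_roots p' \<subseteq> inv_roots (s \<otimes> w)" "q' \<in> carrier G"
        "inv_roots q' \<subseteq> inv_roots (s \<otimes> w')"
        using run_image[OF runs(1) u's(1,2) sw(1)] run_image[OF runs(2) u's(1,2) sw(2)]
          generate_carrier[OF u's(2)] by auto
      moreover from this have "simple s \<notin> inv_roots p'" "simple s \<notin> inv_roots q'"
        using inv_roots_mult_down(1)[OF s(1) wc(1) ns] inv_roots_mult_down(1)[OF s(1) wc(2) ns']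
          by auto
      ultimately show ?thesis using inv_roots_up_mono[OF s(1)] by blast
    qed
    consider "simple s \<notin> inv_roots y" | "simple s \<in> inv_roots x" | "simple s \<in> inv_roots y"
      "simple s \<notin> inv_roots x"
      by blast
    then show ?thesis
    proof cases
      case 1
      then show ?thesis using skip_mono[OF less.prems(3-5) subset_refl _ less.prems(6,7)] by blast
    next
      case 2
      then have sy: "simple s \<in> inv_roots y" using less.prems(5) by blast
      obtain p' C' where p': "p = s \<otimes> p'" "run (u' @ [s]) (s \<otimes> x) p' C'"
        using less.prems(6) 2 unfolding Cons by (auto elim: run.cases)
      obtain q' D' where q': "q = s \<otimes> q'" "run (u' @ [s]) (s \<otimes> y) q' D'"
        using less.prems(7) sy unfolding Cons by (auto elim: run.cases)
      show ?thesis using up_mono[OF less.prems(3-5) subset_refl 2 p'(2) q'(2)] p'(1) q'(1) by simp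
    next
      case 3
      obtain q' D' where q': "q = s \<otimes> q'" "run (u' @ [s]) (s \<otimes> y) q' D'"
        using less.prems(7) 3(1) unfolding Cons by (auto elim: run.cases)
      obtain x' j where x': "x' \<in> generate G (set u)" "inv_roots x \<subseteq> inv_roots x'"
        "simple s \<notin> inv_roots x'" "inv_roots x' \<subseteq> inv_roots y"
          "j \<in> S" "act (inv x') (simple s) = simple j"
        using exists_cover[OF less.prems(2-5) _ 3] Cons by (metis list.set_intros(1))
      have x'c: "x' \<in> carrier G" using x' less.prems generate_carrier by blast
      have x's: "x' \<in> generate G (set (u' @ [s]))" "x' \<in> generate G (set (s # u'))"
        using x'(1) Cons u's(3) by auto
      define y' where "y' = s \<otimes> x'"
      have inv_roots_y': "inv_roots y' = insert (simple s) (inv_roots x')"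
        unfolding y'_def by (rule inv_roots_mult_cover[OF s(1) x'c x'(5,6)])
      have y': "y' \<in> generate G (set u)" "inv_roots y' \<subseteq> inv_roots y" "s \<otimes> y' = x'"
        using gen[OF x's(2)] u's(3) Cons x'(4) 3(1) inv_roots_y' S_cancel[OF s(1) x'c]
        unfolding y'_def by auto
      have less_y: "card (inv_roots x') < card (inv_roots y)"
      proof -
        have "card (inv_roots x') < card (inv_roots y')"
          using inv_roots_y' x'(3) finite_inv_roots[OF x'c] by simp
        also have "\<dots> \<le> card (inv_roots y)" using card_inv_roots_mono[OF yc y'(2)] .
        finally show ?thesis .
      qed
      \<comment> \<open>Both are projections of \<open>x'\<close>: \<open>p2\<close> along
        \<open>s # u'\<close>, where \<open>s\<close> is skipped, and \<open>p3\<close> along the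
        rotated word. They link the chain \<open>p\<close>, \<open>p2\<close>, \<open>p3\<close>,
        \<open>s \<otimes> p3\<close>, \<open>s \<otimes> q'\<close>.\<close>
      obtain p2 C2 where p2: "run u x' p2 C2" using run_exists[OF less.prems(1,2) x'(1)] by blast
      obtain p3 C3 where p3: "run (u' @ [s]) x' p3 C3" using run_exists[OF u's(1,2) x's(1)] by blast
      have "inv_roots p \<subseteq> inv_roots p2"
        by (rule skip_mono[OF less.prems(3) x'(1,2,4,3) less.prems(6) p2])
      also have "\<dots> \<subseteq> inv_roots p3"
      proof -
        obtain v E where v: "v \<in> generate G (set u')"
          "inv_roots v = inv_roots x' \<inter> supported (set u')" "run u' v p2 E"
          using p2 x'(3) unfolding Cons by (auto elim: run.cases)
        have p2v: "p2 \<in> generate G (set u')" "inv_roots p2 \<subseteq> inv_roots v"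
          using run_image[OF v(3) s(2,3) v(1)] by auto
        obtain E' where "run u' p2 p2 E'" using run_idem[OF v(3) s(2,3) v(1)] by blast
        then obtain E'' where E'': "run (u' @ [s]) p2 p2 E''"
          using run_insert[of u' p2 p2 E' u' "[]" s] s p2v(1) by auto
        have "p2 \<in> generate G (set (u' @ [s]))" using generate_mono[OF _ p2v(1)] by auto
        moreover have "inv_roots p2 \<subseteq> inv_roots x'" using p2v(2) v(2) by blast
        \<comment> \<open>The rotated word is as long as \<open>u\<close>; the measure drops because
          \<open>x'\<close> has fewer inversions than \<open>y\<close>.\<close>
        ultimately show ?thesis
          using less.hyps[OF _ u's(1,2) _ x's(1) _ E'' p3] less_y u's(4) by simp
      qed
      also have "\<dots> \<subseteq> inv_roots (s \<otimes> p3)" by (rule run_cover[OF su x's(2) p3 x'(5,6)])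
      also have "\<dots> \<subseteq> inv_roots (s \<otimes> q')"
      proof (rule up_mono[OF y'(1) less.prems(4) y'(2) subset_refl _ _ q'(2)])
        show "simple s \<in> inv_roots y'" unfolding inv_roots_y' by blast
        show "run (u' @ [s]) (s \<otimes> y') p3 C3" using p3 y'(3) by simp
      qed
      finally show ?thesis using q'(1) by simp
    qed
  qed
qed

section \<open>Independence of the choice of initial letters\<close>

text \<open>The test vector \<open>x\<close> has coordinate 1 at \<open>r\<close>, and the word
  \<open>u\<close> turns this into -1. Only the letter \<open>r\<close> can change that coordinate,
  so \<open>v\<close> must contain it.\<close>

lemma word_support:
  assumes "distinct u" "set u \<subseteq> S" "v \<in> lists S" "word_prod G v = word_prod G u"
  shows "set u \<subseteq> set v"
proof
  fix r assume "r \<in> set u"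
  then obtain a c where u: "u = a @ r # c" by (meson split_list)
  have rS: "r \<in> S" "r \<notin> set a" "r \<notin> set (rev c)" "c \<in> lists S" "u \<in> lists S"
    using assms(1,2) u by auto
  define x where "x = word_refl (rev c) (simple r)"
  have "word_refl u x = word_refl a (simple_refl r (simple r))"
    using word_refl_rev[of "rev c" "simple r"] rS(4)
      by (simp add: u x_def word_refl_append in_lists_conv_set)
  then have "word_refl u x r = -1"
    using word_refl_other[OF rS(2)] rS(1) by (simp add: simple_refl_simple_self)
  moreover have "word_refl v x = word_refl u x"
    using act_word[OF assms(3)] act_word[OF rS(5)] assms(4) by metis
  moreover have "x r = 1" unfolding x_def using word_refl_other[OF rS(3)] by simp
  ultimately show "r \<in> set v" using word_refl_other[of r v x] by fastforce
qed

lemma distinct_word_length: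
  assumes "distinct u" "set u \<subseteq> S"
  shows "cox_length G (set u) (word_prod G u) = length u"
proof (rule antisym)
  show "cox_length G (set u) (word_prod G u) \<le> length u"
    by (rule cox_length_le) auto
  obtain v where v: "v \<in> lists (set u)" "word_prod G v = word_prod G u"
      "length v = cox_length G (set u) (word_prod G u)"
    using reduced_exists[OF assms(2) wp_in_generate[OF assms(2)], of u] by blast
  then have "card (set u) \<le> card (set v)"
    using word_support[OF assms _ v(2)] lists_S[OF assms(2) v(1)] by (intro card_mono) auto
  then show "length u \<le> cox_length G (set u) (word_prod G u)"
    using card_length[of v] distinct_card[OF assms(1)] v(3) by simp
qed

lemma initial_letter_word:
  assumes "distinct u" "set u \<subseteq> S" "initial_letter G (set u) (word_prod G u) s"
  obtains u' where "distinct (s # u')" "set (s # u') = set u" "word_prod G (s # u') = word_prod G u"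
proof -
  obtain u' where u': "s # u' \<in> lists (set u)" "word_prod G (s # u') = word_prod G u"
      "length (s # u') = cox_length G (set u) (word_prod G u)"
    using assms(3) unfolding initial_letter_def reduced_word_def by blast
  have set: "set (s # u') = set u"
    using u'(1) word_support[OF assms(1,2) lists_S[OF assms(2) u'(1)] u'(2)] by auto
  then have "distinct (s # u')"
    using u'(3) distinct_word_length[OF assms(1,2)] distinct_card[OF assms(1)]
    by (intro card_distinct) simp
  then show ?thesis using that set u'(2) by blast
qed

lemma initial_letter_Cons:
  assumes "distinct (s # u)" "set (s # u) \<subseteq> S"
  shows "initial_letter G (set (s # u)) (word_prod G (s # u)) s"
  unfolding initial_letter_def reduced_word_def
  using distinct_word_length[OF assms] by (intro exI[of _ u]) auto

text \<open>Each coordinate is changed by its own letter only, which occurs once; so nothing can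
  cancel and every single letter must act trivially.\<close>

lemma word_fixes_simple:
  "distinct a \<Longrightarrow> set a \<subseteq> S \<Longrightarrow> s \<in> S \<Longrightarrow> s \<notin> set a \<Longrightarrow> word_refl a (simple s) = simple s \<Longrightarrow>
    x \<in> set a \<Longrightarrow> form_entry s x = 0"
proof (induction a)
  case (Cons y a)
  have ya: "word_refl a (simple s) = simple s"
  proof
    fix z
    show "word_refl a (simple s) z = simple s z"
    proof (cases "z = y")
      case True
      then show ?thesis using Cons.prems(1) by (simp add: word_refl_other)
    next
      case False
      then have "word_refl (y # a) (simple s) z = word_refl a (simple s) z"
        by (simp add: simple_refl_other)
      then show ?thesis using Cons.prems(5) by simp
    qed
  qed
  then have "simple_refl y (simple s) y = simple s y" using Cons.prems(5) by simp
  then have "form_entry y s = 0" using Cons.prems(3)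
    by (simp add: simple_refl_at form_simple_simple)
  then show ?case using Cons ya form_entry_sym[of s y] by auto
qed simp

text \<open>\<open>simple s\<close> is an inversion of the element, so exchange in \<open>u'\<close>
  presents it as the image of some \<open>simple r\<close> under the prefix \<open>a\<close>. The
  prefix leaves the coordinate at \<open>r\<close> alone, whence \<open>r = s\<close>, and
  \<open>a\<close> fixes \<open>simple s\<close>. So \<open>s\<close> can be moved to the front
  through commuting letters.\<close>

lemma same_element_first_letters:
  assumes "distinct (s # u)" "distinct u'" "set (s # u) = set u'" "set (s # u) \<subseteq> S"
    and "word_prod G (s # u) = word_prod G u'"
  obtains a c where "u' = a @ s # c" "\<And>x. x \<in> set a \<Longrightarrow> form_entry s x = 0"
    "word_prod G a \<otimes> s = s \<otimes> word_prod G a" "word_prod G u = word_prod G (a @ c)"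
proof -
  have s: "s \<in> S" "s \<notin> set u" "set u \<subseteq> S" "u \<in> lists S" using assms by auto
  have uc: "word_prod G u \<in> carrier G" using wp_closed s by blast
  have "simple s \<notin> inv_roots (word_prod G u)"
    using inv_roots_supported[OF s(3) wp_in_generate[OF s(3)], of u] s(2) simple_supported_iff
    by (metis in_listsI subsetD)
  then have "simple s \<in> inv_roots (word_prod G u')"
    using inv_roots_mult_up[OF s(1) uc] assms(5) by auto
  moreover have "u' \<in> lists S" using assms by auto
  ultimately obtain a r c where arc: "u' = a @ r # c" "simple s = word_refl a (simple r)"
    using inv_roots_exchange by blast
  have r: "r \<notin> set a" using assms(2) arc(1) by simp
  have "simple s r = 1" using arc(2) word_refl_other[OF r] by simp
  then have rs: "r = s" by (simp add: simple_def split: if_splits)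
  have ac: "set a \<subseteq> S" "distinct a" "a \<in> lists S" "c \<in> lists S" "s # c \<in> lists S"
    using assms arc(1) s by auto
  have fixed: "word_refl a (simple s) = simple s" using arc(2)[symmetric] unfolding rs .
  have zero: "form_entry s x = 0" if "x \<in> set a" for x
    using word_fixes_simple[OF ac(2,1) s(1) _ fixed that] r rs by simp
  have A: "word_prod G a \<in> carrier G" "word_prod G c \<in> carrier G" "s \<in> carrier G"
    using wp_closed ac S_carrier s by auto
  have "word_prod G a \<otimes> s \<otimes> inv (word_prod G a) = s"
    using root_reflection_act[OF A(1) s(1)]
      by (simp add: act_word[OF ac(3)] fixed root_reflection_simple s)
  then have comm: "word_prod G a \<otimes> s = s \<otimes> word_prod G a"
    using A by (metis inv_solve_right m_closed)
  have "word_prod G u' = word_prod G a \<otimes> s \<otimes> word_prod G c"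
    using arc(1) rs A wp_append[OF ac(3,5)] by (simp add: m_assoc)
  also have "\<dots> = s \<otimes> word_prod G (a @ c)"
    unfolding comm wp_append[OF ac(3,4)] using A by (simp add: m_assoc)
  finally have "word_prod G u' = s \<otimes> word_prod G (a @ c)" .
  then have "s \<otimes> word_prod G u = s \<otimes> word_prod G (a @ c)" using assms(5) by simp
  then have "word_prod G u = word_prod G (a @ c)"
    using A uc by (simp add: wp_append ac)
  then show ?thesis using that arc(1) rs zero comm by blast
qed

lemma simple_refl_simple_commuting:
  "r \<in> S \<Longrightarrow> s \<in> S \<Longrightarrow> form_entry s r = 0 \<Longrightarrow> simple_refl r (simple s) = simple s"
  using form_entry_sym[of r s] by (simp add: simple_refl_def lincomb_def form_simple_simple)

lemma commuting:
  assumes "r \<in> S" "s \<in> S" "form_entry s r = 0"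
  shows "r \<otimes> s = s \<otimes> r"
proof -
  have "r \<otimes> s \<otimes> inv r = s"
    using root_reflection_act[OF S_carrier[OF assms(1)] assms(2)] assms
    by (simp add: act_simple simple_refl_simple_commuting root_reflection_simple)
  then show ?thesis using assms S_carrier by (metis inv_solve_right m_closed)
qed

lemma simple_mem_inv_roots_commuting:
  assumes "r \<in> S" "s \<in> S" "form_entry s r = 0" "w \<in> carrier G" "s \<noteq> r"
  shows "simple s \<in> inv_roots (r \<otimes> w) \<longleftrightarrow> simple s \<in> inv_roots w"
proof -
  have "act (inv (r \<otimes> w)) (simple s) = act (inv w) (simple s)"
    using assms S_carrier
      by (simp add: inv_mult_group S_inv act_mult act_simple simple_refl_simple_commuting)
  then show ?thesis by (simp add: inv_roots_def)
qed

lemma simple_refl_supported_iff: "s \<in> S \<Longrightarrow> s \<in> J \<Longrightarrow> simple_refl s \<beta> \<in> supported J \<longleftrightarrow> \<beta> \<in> supported J"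
  using simple_refl_supported simple_refl_simple_refl by metis

text \<open>For \<open>s\<close> in \<open>J\<close> the reflection preserves the support condition,
  so going down by \<open>s\<close> commutes with taking the parabolic part.\<close>

lemma inv_roots_down_supported:
  assumes "s \<in> S" "s \<in> J" "v \<in> carrier G" "w \<in> carrier G" "simple s \<in> inv_roots w"
    and "inv_roots v = inv_roots w \<inter> supported J"
  shows "inv_roots (s \<otimes> v) = inv_roots (s \<otimes> w) \<inter> supported J"
proof -
  have down: "\<beta> \<in> inv_roots (s \<otimes> z) \<longleftrightarrow> \<beta> \<in> pos_roots \<and> \<beta> \<noteq> simple s \<and> simple_refl s \<beta> \<in> inv_roots z"
    if z: "z \<in> carrier G" "simple s \<in> inv_roots z" for z \<beta>
  proof
    assume "\<beta> \<in> inv_roots (s \<otimes> z)"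
    then show "\<beta> \<in> pos_roots \<and> \<beta> \<noteq> simple s \<and> simple_refl s \<beta> \<in> inv_roots z"
      using inv_roots_mult_down(1)[OF assms(1) z] inv_roots_pos simple_refl_mem_inv_roots_down[OF assms(1) z]
        by blast
  next
    assume \<beta>: "\<beta> \<in> pos_roots \<and> \<beta> \<noteq> simple s \<and> simple_refl s \<beta> \<in> inv_roots z"
    then have "simple_refl s \<beta> \<in> simple_refl s ` inv_roots (s \<otimes> z)"
      using inv_roots_mult_down(2)[OF assms(1) z] simple_refl_ne_simple[OF assms(1)] by blast
    then show "\<beta> \<in> inv_roots (s \<otimes> z)" using simple_refl_simple_refl[OF assms(1)] by (metis imageE)
  qed
  have v: "simple s \<in> inv_roots v" using assms simple_supported_iff by blast
  show ?thesis
    unfolding set_eq_iff Int_iff down[OF assms(3) v] down[OF assms(4,5)] assms(6)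
    using simple_refl_supported_iff[OF assms(1,2)] by auto
qed

lemma inv_roots_up_supported:
  assumes "s \<in> S" "s \<in> J" "v \<in> carrier G" "w \<in> carrier G" "simple s \<in> inv_roots w"
    and "inv_roots v = inv_roots (s \<otimes> w) \<inter> supported J"
  shows "inv_roots (s \<otimes> v) = inv_roots w \<inter> supported J"
proof -
  have "simple s \<notin> inv_roots v" using assms(6) inv_roots_mult_down(1)[OF assms(1,4,5)] by blast
  then have "inv_roots (s \<otimes> v) = insert (simple s) (simple_refl s ` (inv_roots (s \<otimes> w) \<inter> supported J))"
    using inv_roots_mult_up[OF assms(1,3)] assms(6) by simp
  also have "\<dots> = insert (simple s) (simple_refl s ` inv_roots (s \<otimes> w)) \<inter> supported J"
    using simple_refl_supported_iff[OF assms(1,2)] simple_supported_iff[of s J] assms(2)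
    by (auto simp: simple_refl_simple_refl[OF assms(1)])
  also have "\<dots> = inv_roots w \<inter> supported J" using inv_roots_mult_down(2)[OF assms(1,4,5)] by simp
  finally show ?thesis .
qed

text \<open>Words with the same first letter reduce to smaller instances. Words with different first
  letters are connected through two words that differ only by exchanging two commuting first
  letters, and for those the runs are compared directly.\<close>

lemma run_same_element:
  assumes "run u w p C" "distinct u" "distinct u'" "set u = set u'" "set u \<subseteq> S"
    and "w \<in> generate G (set u)" "word_prod G u = word_prod G u'"
  shows "\<exists>D. run u' w p D"
  using assms
proof (induction "length u + card (inv_roots w)" arbitrary: u u' w p C rule: less_induct)
  case less
  have w: "w \<in> carrier G" using less.prems generate_carrier by blast
  have same: "\<exists>D. run (s # z') w p D"
    if "run (s # z) w p C'" "distinct (s # z)" "distinct (s # z')" "set (s # z) = set u"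
      "set (s # z') = set u"
      "word_prod G (s # z) = word_prod G (s # z')" "length z < length u" for s z z' C'
  proof -
    have s: "s \<in> S" "set z \<subseteq> S" "set z' \<subseteq> S" "s \<notin> set z" using that less.prems by auto
    have zl: "z \<in> lists S" "z' \<in> lists S" using s by auto
    have set: "set z = set z'" using that by auto
    have prod: "word_prod G z = word_prod G z'"
      using that(6) wp_closed zl S_carrier[OF s(1)] by simp
    from that(1) show ?thesis
    proof (cases rule: run.cases)
      case (up p' C')
      have "s \<otimes> w \<in> generate G (set (z @ [s]))"
        using generate_down[of s "set u" w] less.prems(6) that(4) by (metis Un_insert_right
            list.set_intros(1) list.simps(15) set_append sup_bot.right_neutral list.set(1))
      then have "\<exists>D. run (z' @ [s]) (s \<otimes> w) p' D"
        using less.hyps[of "z @ [s]" "s \<otimes> w" p' C' "z' @ [s]"] card_inv_roots_down[OF s(1) w up(3)]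
          up(4) that set prod s zl S_carrier[OF s(1)] by (auto simp: wp_append)
      then show ?thesis using run.up[OF up(3)] up(1) by blast
    next
      case (skip v C')
      have "card (inv_roots v) \<le> card (inv_roots w)" using card_inv_roots_mono[OF w] skip(4)
        by blast
      then have "\<exists>D. run z' v p D"
        using less.hyps[of z v p C' z'] skip that set prod s by auto
      then show ?thesis using run.skip[OF skip(2), of v z'] skip set by auto
    qed
  qed
  show ?case
  proof (cases u)
    case Nil
    then show ?thesis using less.prems by auto
  next
    case (Cons s u1)
    have su: "distinct (s # u1)" "set (s # u1) = set u'" "set (s # u1) \<subseteq> S"
        "word_prod G (s # u1) = word_prod G u'" using less.prems Cons by auto
    obtain a c where ac: "u' = a @ s # c" "\<And>x. x \<in> set a \<Longrightarrow> form_entry s x = 0"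
        "word_prod G a \<otimes> s = s \<otimes> word_prod G a" "word_prod G u1 = word_prod G (a @ c)"
      using same_element_first_letters[OF su(1) less.prems(3) su(2-4)] by blast
    show ?thesis
    proof (cases a)
      case Nil
      then show ?thesis
        using same[of s u1 C c] less.prems ac(1) Cons by auto
    next
      case a: (Cons r a')
      \<comment> \<open>The chain of words is \<open>s # u1\<close>, \<open>s # r # z\<close>,
        \<open>r # s # z\<close>, \<open>u'\<close>: the outer steps keep the first letter, the
        middle one exchanges it with the second.\<close>
      define z where "z = a' @ c"
      have rs: "r \<in> S" "s \<in> S" "form_entry s r = 0" "form_entry r s = 0" "s \<noteq> r" "set a' \<subseteq> S"
        "set c \<subseteq> S"
        using su ac(1,2) a less.prems(3) form_entry_sym[of r s] by auto
      have wl: "a' \<in> lists S" "c \<in> lists S" "z \<in> lists S" "a \<in> lists S"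
        using rs a by (auto simp: z_def)
      have car: "r \<in> carrier G" "s \<in> carrier G" "word_prod G a' \<in> carrier G"
        "word_prod G c \<in> carrier G"
          "word_prod G z \<in> carrier G"
        using rs wl wp_closed S_carrier by auto
      have rs_comm: "r \<otimes> s = s \<otimes> r" using commuting[OF rs(1-3)] .
      have d: "distinct (s # r # z)" "set (s # r # z) = set u" "distinct (r # s # z)"
          "length z + 2 = length u"
        using less.prems(2-4) ac(1) a Cons distinct_card[of u] distinct_card[of u']
        by (auto simp: z_def)
      have p1: "word_prod G (s # r # z) = word_prod G u"
        using ac(4) a Cons by (simp add: z_def)
      have p2: "word_prod G (r # s # z) = word_prod G u'"
        using p1 less.prems(7) rs_comm car by (simp add: m_assoc[symmetric])
      obtain D1 where run1: "run (s # r # z) w p D1"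
        using same[of s u1 C "r # z"] less.prems Cons d p1 by auto
      have zS: "set (r # z) \<subseteq> S" "set (s # z) \<subseteq> S" "set z \<subseteq> S"
        using rs by (auto simp: z_def)
      \<comment> \<open>Since \<open>r\<close> and \<open>s\<close> commute, handling one of them
        does not affect whether the element is above the other. This leaves four combinations of
        rotating and skipping.\<close>
      have "\<exists>D. run (r # s # z) w p D"
        using run1
      proof (cases rule: run.cases)
        case (up p1 C1)
        have sw: "s \<otimes> w \<in> carrier G" using w car by simp
        have r_iff: "simple r \<in> inv_roots (s \<otimes> w) \<longleftrightarrow> simple r \<in> inv_roots w"
          using simple_mem_inv_roots_commuting[OF rs(2,1,4) w] rs(5) by blast
        have "run (r # z @ [s]) (s \<otimes> w) p1 C1" using up(4) by simp
        then show ?thesis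
        proof (cases rule: run.cases)
          case up': (up p2 C2)
          have rw: "r \<otimes> w \<in> carrier G" "simple r \<in> inv_roots w" using w car up'(3) r_iff by auto
          have srw: "r \<otimes> (s \<otimes> w) = s \<otimes> (r \<otimes> w)" using rs_comm car w
            by (simp add: m_assoc[symmetric])
          have s_in: "simple s \<in> inv_roots (r \<otimes> w)"
            using simple_mem_inv_roots_commuting[OF rs(1,2,3) w rs(5)] up(3) by simp
          have g: "r \<otimes> (s \<otimes> w) \<in> generate G (set ((z @ [s]) @ [r]))"
            using generate_down[of r "set u"] generate_down[of s "set u" w] less.prems(6) d(2)
            by (simp add: insert_commute flip: d(2))
          have "card (inv_roots (r \<otimes> (s \<otimes> w))) < card (inv_roots w)"
            using card_inv_roots_down[OF rs(1) sw up'(3)] card_inv_roots_down[OF rs(2) w up(3)]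
              by simp
          \<comment> \<open>After two rotations the letters arrive at the end in opposite orders;
            these words represent the same element, so the induction hypothesis applies.\<close>
          moreover have "word_prod G ((z @ [s]) @ [r]) = word_prod G ((z @ [r]) @ [s])"
            using wl rs car rs_comm by (simp add: wp_append m_assoc)
          ultimately obtain D where "run ((z @ [r]) @ [s]) (r \<otimes> (s \<otimes> w)) p2 D"
            using less.hyps[OF _ up'(4) _ _ _ _ g, of "(z @ [r]) @ [s]"] d rs zS by auto
          then have "run (s # z @ [r]) (r \<otimes> w) (s \<otimes> p2) (simple_refl s ` D)"
            using run.up[OF s_in] srw by simp
          then have "run (r # s # z) w (r \<otimes> (s \<otimes> p2)) (simple_refl r ` simple_refl s ` D)"
            using run.up[OF rw(2)] by simp
          moreover have "p2 \<in> carrier G"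
            using run_image[OF up'(4) _ _ g] d zS rs less.prems(5) generate_carrier[of "set ((z @ [s]) @ [r])"]
              by auto
          then have "r \<otimes> (s \<otimes> p2) = p"
            using up(1) up'(1) rs_comm car by (simp add: m_assoc[symmetric])
          ultimately show ?thesis by blast
        next
          case skip: (skip v C2)
          have r_out: "simple r \<notin> inv_roots w" using skip(2) r_iff by blast
          have v: "v \<in> generate G (set (s # z))"
            "inv_roots v = inv_roots (s \<otimes> w) \<inter> supported (set (s # z))"
            using skip(3,4) by auto
          have vc: "v \<in> carrier G" using generate_carrier[OF zS(2) v(1)] .
          have "inv_roots (s \<otimes> v) = inv_roots w \<inter> supported (set (s # z))"
            using inv_roots_up_supported[OF rs(2) _ vc w up(3) v(2)] by simp
          moreover from this have "simple s \<in> inv_roots (s \<otimes> v)"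
            using up(3) simple_supported_iff[of s "set (s # z)"] by simp
          then have "run (s # z) (s \<otimes> v) (s \<otimes> p1) (simple_refl s ` C2)"
            using run.up[of s "s \<otimes> v" z p1 C2] skip(5) S_cancel[OF rs(2) vc] by simp
          moreover have "s \<otimes> v \<in> generate G (set (s # z))" using generate_down[OF _ v(1)] by simp
          ultimately show ?thesis using run.skip[OF r_out] up(1) by blast
        qed
      next
        case (skip v C1)
        have vc: "v \<in> carrier G" using generate_carrier[OF zS(1) skip(3)] .
        have r_iff: "simple r \<in> inv_roots v \<longleftrightarrow> simple r \<in> inv_roots w"
          using skip(4) simple_supported_iff[of r "set (r # z)"] by auto
        from skip(5) show ?thesis
        proof (cases rule: run.cases)
          case (up p1 C2)
          have rw: "r \<otimes> w \<in> carrier G" "simple r \<in> inv_roots w" using w car up(3) r_iff by auto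
          have "simple s \<notin> inv_roots (r \<otimes> w)"
            using simple_mem_inv_roots_commuting[OF rs(1,2,3) w rs(5)] skip(2) by simp
          moreover have "r \<otimes> v \<in> generate G (set (z @ [r]))"
            using generate_down[OF _ skip(3), of r] by simp
          moreover have "inv_roots (r \<otimes> v) = inv_roots (r \<otimes> w) \<inter> supported (set (z @ [r]))"
            using inv_roots_down_supported[OF rs(1) _ vc w rw(2) skip(4)] by simp
          ultimately have "run (s # z @ [r]) (r \<otimes> w) p1 (insert (simple s) C2)"
            using run.skip up(4) by blast
          then show ?thesis using run.up[OF rw(2), of "s # z"] up(1) by auto
        next
          case skip': (skip v' C2)
          have r_out: "simple r \<notin> inv_roots w" using skip'(2) r_iff by blast
          obtain y where y: "y \<in> generate G (set (s # z))"
            "inv_roots y = inv_roots w \<inter> supported (set (s # z))"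
            using parabolic_exists[OF zS(2) w] .
          have sub: "supported (set z) \<subseteq> supported (set (s # z))"
            "supported (set z) \<subseteq> supported (set (r # z))"
            by (auto intro!: supported_mono)
          have "inv_roots v' = inv_roots y \<inter> supported (set z)"
            using skip'(4) skip(4) y(2) sub by auto
          moreover have "simple s \<notin> inv_roots y" using skip(2) y(2) by blast
          ultimately have "run (s # z) y p (insert (simple s) C2)"
            using run.skip skip'(3,5) by blast
          then show ?thesis using run.skip[OF r_out y] by blast
        qed
      qed
      then obtain D2 where run2: "run (r # s # z) w p D2" by blast
      show ?thesis
        using same[OF run2 d(3), of "a' @ s # c"] d less.prems(3,4) ac(1) a p2 by auto
    qed
  qed
qed

section \<open>Identification with the recursively defined projection\<close>

text \<open>Each chosen initial letter begins some word of the Coxeter element without repetitions,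
  and independence of the word leads back to \<open>u\<close>. The relation may stop at the identity
  while letters remain; \<open>run\<close> goes on through them but can only return the
  identity.\<close>

lemma pi_down_rel_run:
  assumes "pi_down_rel G J c w p" "J \<subseteq> S" "w \<in> generate G J"
    and "distinct u" "set u = J" "word_prod G u = c"
  shows "\<exists>C. run u w p C"
  using assms
proof (induction arbitrary: u rule: pi_down_rel.induct)
  case (one J c)
  obtain p C where run: "run u \<one> p C" using run_exists[of u \<one>] one generate.one by blast
  then have "p \<in> carrier G" "inv_roots p \<subseteq> inv_roots \<one>"
    using run_image[OF run] one generate_carrier[of J p] generate.one by auto
  then have "p = \<one>" using inv_roots_inj[of p \<one>] inv_roots_one by auto
  then show ?case using run by blast
next
  case (above J c s w p)
  obtain u' where u': "distinct (s # u')" "set (s # u') = J" "word_prod G (s # u') = c"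
    using initial_letter_word[of u s] above by metis
  have s: "s \<in> S" "u' \<in> lists S" "s \<in> J" using u' above.prems by auto
  have w: "simple s \<in> inv_roots w"
    using weak_le_simple_iff[OF above.prems(1) s(3) above.prems(2)] above.hyps by blast
  have "\<exists>C. run (u' @ [s]) (s \<otimes> w) p C"
  proof (rule above.IH[OF above.prems(1)])
    show "s \<otimes> w \<in> generate G J" using generate_down[OF s(3) above.prems(2)] .
    show "word_prod G (u' @ [s]) = s \<otimes> c \<otimes> s"
      using u'(3) s S_cancel[OF s(1)] wp_closed[OF s(2)] S_carrier[OF s(1)]
        by (auto simp: wp_append)
  qed (use u' in auto)
  then obtain C where "run (s # u') w (s \<otimes> p) C" using run.up[OF w] by blast
  then show ?case
    using run_same_element[of "s # u'" w "s \<otimes> p" C u] u' above.prems by simp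
next
  case (not_above J c s w p)
  obtain u' where u': "distinct (s # u')" "set (s # u') = J" "word_prod G (s # u') = c"
    using initial_letter_word[of u s] not_above by metis
  have s: "s \<in> S" "u' \<in> lists S" "s \<in> J" "J - {s} = set u'" "set u' \<subseteq> S"
    using u' not_above.prems by auto
  have w: "simple s \<notin> inv_roots w"
    using weak_le_simple_iff[OF not_above.prems(1) s(3) not_above.prems(2)] not_above.hyps by blast
  define v where "v = parabolic_part G J (J - {s}) w"
  have v: "v \<in> generate G (set u')" "inv_roots v = inv_roots w \<inter> supported (set u')"
    using parabolic_part[OF not_above.prems(1) _ not_above.prems(2), of "J - {s}"]
    unfolding v_def s(4)[symmetric] by auto
  have "\<exists>C. run u' v p C"
  proof (rule not_above.IH[folded v_def])
    show "word_prod G u' = s \<otimes> c"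
      using u'(3) S_cancel[OF s(1)] wp_closed[OF s(2)] by auto
  qed (use u' s v in auto)
  then obtain C where "run (s # u') w p C" using run.skip[OF w v] by blast
  then show ?case
    using run_same_element[of "s # u'" w p C u] u' not_above.prems by simp
qed

text \<open>A word without repetitions is reduced, so its first letter is initial and
  \<open>run\<close> makes admissible choices throughout.\<close>

lemma run_pi_down_rel:
  "run u w p C \<Longrightarrow> distinct u \<Longrightarrow> set u \<subseteq> S \<Longrightarrow> w \<in> generate G (set u) \<Longrightarrow>
    pi_down_rel G (set u) (word_prod G u) w p"
proof (induction rule: run.induct)
  case stop
  show ?case by (rule pi_down_rel.one)
next
  case (up s w u p C)
  have s: "s \<in> S" "u \<in> lists S" "set (u @ [s]) = set (s # u)" using up.prems by auto
  have "pi_down_rel G (set (u @ [s])) (word_prod G (u @ [s])) (s \<otimes> w) p"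
    using up.IH up.prems generate_down[OF _ up.prems(3), of s] s(3) by auto
  moreover have "word_prod G (u @ [s]) = s \<otimes> word_prod G (s # u) \<otimes> s"
    using s S_cancel[OF s(1)] wp_closed[OF s(2)] S_carrier[OF s(1)] by (auto simp: wp_append)
  moreover have "weak_le G (set (s # u)) s w"
    using weak_le_simple_iff[OF up.prems(2) _ up.prems(3)] up.hyps(1) by simp
  ultimately show ?case
    using pi_down_rel.above[OF initial_letter_Cons[OF up.prems(1,2)]] s(3) by metis
next
  case (skip s w v u p C)
  have s: "s \<in> S" "u \<in> lists S" "set (s # u) - {s} = set u" "set u \<subseteq> S" using skip.prems by auto
  let ?v = "parabolic_part G (set (s # u)) (set (s # u) - {s}) w"
  have pp: "?v \<in> generate G (set u)" "inv_roots ?v = inv_roots w \<inter> supported (set u)"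
    using parabolic_part[OF skip.prems(2) _ skip.prems(3), of "set (s # u) - {s}"] unfolding s(3)
      by auto
  have "?v = v"
    using inv_roots_inj[of ?v v] generate_carrier[OF s(4)] pp skip.hyps(2,3) by auto
  moreover have "pi_down_rel G (set u) (word_prod G u) v p" using skip by simp
  moreover have "word_prod G u = s \<otimes> word_prod G (s # u)"
    using S_cancel[OF s(1)] wp_closed[OF s(2)] by simp
  moreover have "\<not> weak_le G (set (s # u)) s w"
    using weak_le_simple_iff[OF skip.prems(2) _ skip.prems(3)] skip.hyps(1) by simp
  ultimately show ?case
    using pi_down_rel.not_above[OF initial_letter_Cons[OF skip.prems(1,2)]] s(3) by metis
qed

lemma pi_down_run:
  assumes "distinct u" "set u \<subseteq> S" "w \<in> generate G (set u)" "run u w p C"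
  shows "pi_down G (set u) (word_prod G u) w = p"
  unfolding pi_down_def
proof (rule the_equality)
  show "pi_down_rel G (set u) (word_prod G u) w p" using run_pi_down_rel assms by blast
  show "q = p" if "pi_down_rel G (set u) (word_prod G u) w q" for q
    using pi_down_rel_run[OF that assms(2,3,1)] run_deterministic[OF assms(4,1,2)] by blast
qed

end

theorem theorem6p1:
  fixes G :: "('a, 'b) monoid_scheme" and S :: "'a set" and c x y :: 'a
  assumes "coxeter_system G S"
    and "finite S"
    and "coxeter_element G S c"
    and "weak_le G S x y"
  shows "weak_le G S (pi_down G S c x) (pi_down G S c y)"
proof -
  interpret coxeter_system G S by fact
  obtain m where "coxeter_matrix S m"
    "\<forall>u\<in>lists S. \<forall>v\<in>lists S. word_prod G u = word_prod G v \<longleftrightarrow> cox_cong S m u v"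
    using presentation by blast
  then interpret finite_coxeter_system G S m
    using assms(2) by unfold_locales auto
  obtain u where u: "distinct u" "set u = S" "word_prod G u = c"
    using assms(3) by (auto simp: coxeter_element_def)
  have xy: "x \<in> generate G S" "y \<in> generate G S" "inv_roots x \<subseteq> inv_roots y"
    using assms(4) by (auto simp: weak_le_iff)
  have "\<exists>p C. run u x p C" "\<exists>q D. run u y q D"
    using run_exists[of u] u xy by auto
  then obtain p C q D where runs: "run u x p C" "run u y q D" by blast
  have "pi_down G S c x = p" "pi_down G S c y = q"
    using pi_down_run[of u] runs u xy by auto
  moreover have "inv_roots p \<subseteq> inv_roots q" using run_mono[of u x y] runs u xy by blast
  moreover have "p \<in> generate G S" "q \<in> generate G S"
    using run_image[OF runs(1)] run_image[OF runs(2)] u xy by auto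
  ultimately show ?thesis by (simp add: weak_le_iff)
qed

end
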